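(* Let $\mathcal D$ be a triangulated category endowed with a $t$-structure $({}^p\mathcal D^{\le0},{}^p\mathcal D^{\ge0})$, with heart $\mathcal C$ and cohomology functors ${}^pH^i:\mathcal D\to\mathcal C$. Suppose that $\mathcal C$ is endowed with a torsion theory $(\mathcal T,\mathcal F)$. Then $${}^{p_+}\mathcal D^{\le0}=\{A\in{}^p\mathcal D^{\le1}\mid{}^pH^1(A)\in\mathcal T\},\qquad {}^{p_+}\mathcal D^{\ge0}=\{A\in{}^p\mathcal D^{\ge0}\mid{}^pH^0(A)\in\mathcal F\}$$ defines a $t$-structure $({}^{p_+}\mathcal D^{\le0},{}^{p_+}\mathcal D^{\ge0})$ on $\mathcal D$.
   Context: A $t$-structure on a triangulated category $\mathcal D$ is a pair of strictly full subcategories $(\mathcal D^{\le0},\mathcal D^{\ge0})$ such that, with $\mathcal D^{\le n}=\mathcal D^{\le0}[-n]$ and $\mathcal D^{\ge n}=\mathcal D^{\ge0}[-n]$: (i) $\operatorname{Hom}(X,Y)=0$ for $X\in\mathcal D^{\le0}$, $Y\in\mathcal D^{\ge1}$; (ii) $\mathcal D^{\le0}\subset\mathcal D^{\le1}$ and $\mathcal D^{\ge0}\supset\mathcal D^{\ge1}$; (iii) every $X\in\mathcal D$ lies in a distinguished triangle $(A,X,B)$ with $A\in\mathcal D^{\le0}$, $B\in\mathcal D^{\ge1}$. Its heart is $\mathcal D^{\le0}\cap\mathcal D^{\ge0}$, and $H^0=\tau_{\ge0}\tau_{\le0}$, $H^i(A)=H^0(A[i])$. A torsion theory on an abelian category $\mathcal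 A$ is a pair $(\mathcal T,\mathcal F)$ of full subcategories, closed under isomorphism, such that (i) $\operatorname{Hom}_{\mathcal A}(T,F)=0$ for all $T\in\mathcal T$, $F\in\mathcal F$; (ii) for every $A\in\mathcal A$ there are $T\in\mathcal T$, $F\in\mathcal F$ and a short exact sequence $0\to T\to A\to F\to0$. *)

theory Defs
  imports "HOL-Algebra.Group"
begin

section \<open>Categories\<close>

text \<open>
  Arrows know their source and target, so the hom-sets are disjoint.
  The arrow \<open>g \<cdot> f\<close> is ``first \<open>f\<close>, then \<open>g\<close>''.
\<close>

record ('o, 'a) cat =
  Ob :: "'o set"
  Ar :: "'a set"
  src :: "'a \<Rightarrow> 'o"
  tgt :: "'a \<Rightarrow> 'o"
  idt :: "'o \<Rightarrow> 'a"
  comp :: "'a \<Rightarrow> 'a \<Rightarrow> 'a" (infixr "\<cdot>\<index>" 70)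

definition Hom :: "('o, 'a, 'm) cat_scheme \<Rightarrow> 'o \<Rightarrow> 'o \<Rightarrow> 'a set" where
  "Hom C X Y = {f \<in> Ar C. src C f = X \<and> tgt C f = Y}"

locale category =
  fixes C :: "('o, 'a, 'm) cat_scheme" (structure)
  assumes src_Ob: "f \<in> Ar C \<Longrightarrow> src C f \<in> Ob C"
    and tgt_Ob: "f \<in> Ar C \<Longrightarrow> tgt C f \<in> Ob C"
    and idt_Hom: "X \<in> Ob C \<Longrightarrow> idt C X \<in> Hom C X X"
    and comp_Hom: "\<lbrakk>f \<in> Hom C X Y; g \<in> Hom C Y Z\<rbrakk> \<Longrightarrow> g \<cdot> f \<in> Hom C X Z"
    and comp_idt_right: "f \<in> Hom C X Y \<Longrightarrow> f \<cdot> idt C X = f"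
    and comp_idt_left: "f \<in> Hom C X Y \<Longrightarrow> idt C Y \<cdot> f = f"
    and comp_assoc: "\<lbrakk>f \<in> Hom C W X; g \<in> Hom C X Y; h \<in> Hom C Y Z\<rbrakk>
      \<Longrightarrow> (h \<cdot> g) \<cdot> f = h \<cdot> (g \<cdot> f)"

definition is_iso :: "('o, 'a, 'm) cat_scheme \<Rightarrow> 'a \<Rightarrow> bool" where
  "is_iso C f \<longleftrightarrow> f \<in> Ar C \<and>
    (\<exists>g \<in> Hom C (tgt C f) (src C f).
       g \<cdot>\<^bsub>C\<^esub> f = idt C (src C f) \<and> f \<cdot>\<^bsub>C\<^esub> g = idt C (tgt C f))"

definition isomorphic :: "('o, 'a, 'm) cat_scheme \<Rightarrow> 'o \<Rightarrow> 'o \<Rightarrow> bool" where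
  "isomorphic C X Y \<longleftrightarrow> (\<exists>f \<in> Hom C X Y. is_iso C f)"

text \<open>
  A full subcategory is represented by its set of objects; it is strictly full if that set
  is closed under isomorphism.
\<close>

definition strictly_full :: "('o, 'a, 'm) cat_scheme \<Rightarrow> 'o set \<Rightarrow> bool" where
  "strictly_full C S \<longleftrightarrow> S \<subseteq> Ob C \<and> (\<forall>X \<in> S. \<forall>Y \<in> Ob C. isomorphic C X Y \<longrightarrow> Y \<in> S)"

definition is_zero_object :: "('o, 'a, 'm) cat_scheme \<Rightarrow> 'o \<Rightarrow> bool" where
  "is_zero_object C Z \<longleftrightarrow> Z \<in> Ob C \<and>
    (\<forall>X \<in> Ob C. (\<exists>!f. f \<in> Hom C X Z) \<and> (\<exists>!f. f \<in> Hom C Z X))"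

text \<open>
  The value at \<open>X\<close> of a right (left) adjoint to the inclusion of the full subcategory on \<open>S\<close>,
  given by its counit (unit) \<open>e\<close>.
\<close>

definition is_coreflection ::
  "('o, 'a, 'm) cat_scheme \<Rightarrow> 'o set \<Rightarrow> 'o \<Rightarrow> 'o \<Rightarrow> 'a \<Rightarrow> bool" where
  "is_coreflection C S X A e \<longleftrightarrow> A \<in> S \<and> e \<in> Hom C A X \<and>
    (\<forall>B \<in> S. \<forall>f \<in> Hom C B X. \<exists>!g. g \<in> Hom C B A \<and> e \<cdot>\<^bsub>C\<^esub> g = f)"

definition is_reflection ::
  "('o, 'a, 'm) cat_scheme \<Rightarrow> 'o set \<Rightarrow> 'o \<Rightarrow> 'o \<Rightarrow> 'a \<Rightarrow> bool" where
  "is_reflection C S X A e \<longleftrightarrow> A \<in> S \<and> e \<in> Hom C X A \<and>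
    (\<forall>B \<in> S. \<forall>f \<in> Hom C X B. \<exists>!g. g \<in> Hom C A B \<and> g \<cdot>\<^bsub>C\<^esub> e = f)"


section \<open>Additive categories and short exact sequences\<close>

record ('o, 'a) preadditive_cat = "('o, 'a) cat" +
  plus_ar :: "'a \<Rightarrow> 'a \<Rightarrow> 'a"
  zero_ar :: "'o \<Rightarrow> 'o \<Rightarrow> 'a"

definition Hom_group :: "('o, 'a, 'm) preadditive_cat_scheme \<Rightarrow> 'o \<Rightarrow> 'o \<Rightarrow> 'a monoid" where
  "Hom_group C X Y = \<lparr>carrier = Hom C X Y, mult = plus_ar C, one = zero_ar C X Y\<rparr>"

definition neg_ar :: "('o, 'a, 'm) preadditive_cat_scheme \<Rightarrow> 'a \<Rightarrow> 'a" where
  "neg_ar C f = inv\<^bsub>Hom_group C (src C f) (tgt C f)\<^esub> f"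

locale additive_category = category C
  for C :: "('o, 'a, 'm) preadditive_cat_scheme" (structure) +
  assumes Hom_comm_group: "\<lbrakk>X \<in> Ob C; Y \<in> Ob C\<rbrakk> \<Longrightarrow> comm_group (Hom_group C X Y)"
    and comp_plus_right: "\<lbrakk>f \<in> Hom C X Y; f' \<in> Hom C X Y; g \<in> Hom C Y Z\<rbrakk>
      \<Longrightarrow> g \<cdot> plus_ar C f f' = plus_ar C (g \<cdot> f) (g \<cdot> f')"
    and comp_plus_left: "\<lbrakk>f \<in> Hom C X Y; g \<in> Hom C Y Z; g' \<in> Hom C Y Z\<rbrakk>
      \<Longrightarrow> plus_ar C g g' \<cdot> f = plus_ar C (g \<cdot> f) (g' \<cdot> f)"
    and ex_zero_object: "\<exists>Z. is_zero_object C Z"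
    and ex_biproduct: "\<lbrakk>X \<in> Ob C; Y \<in> Ob C\<rbrakk> \<Longrightarrow>
      \<exists>B \<in> Ob C. \<exists>i \<in> Hom C X B. \<exists>j \<in> Hom C Y B. \<exists>p \<in> Hom C B X. \<exists>q \<in> Hom C B Y.
        p \<cdot> i = idt C X \<and> q \<cdot> j = idt C Y \<and> p \<cdot> j = zero_ar C Y X \<and> q \<cdot> i = zero_ar C X Y \<and>
        plus_ar C (i \<cdot> p) (j \<cdot> q) = idt C B"

definition is_kernel :: "('o, 'a, 'm) preadditive_cat_scheme \<Rightarrow> 'a \<Rightarrow> 'a \<Rightarrow> bool" where
  "is_kernel C k g \<longleftrightarrow> k \<in> Ar C \<and> g \<in> Ar C \<and> tgt C k = src C g \<and>
    g \<cdot>\<^bsub>C\<^esub> k = zero_ar C (src C k) (tgt C g) \<and>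
    (\<forall>X \<in> Ob C. \<forall>x \<in> Hom C X (src C g). g \<cdot>\<^bsub>C\<^esub> x = zero_ar C X (tgt C g) \<longrightarrow>
      (\<exists>!u. u \<in> Hom C X (src C k) \<and> k \<cdot>\<^bsub>C\<^esub> u = x))"

definition is_cokernel :: "('o, 'a, 'm) preadditive_cat_scheme \<Rightarrow> 'a \<Rightarrow> 'a \<Rightarrow> bool" where
  "is_cokernel C q f \<longleftrightarrow> q \<in> Ar C \<and> f \<in> Ar C \<and> tgt C f = src C q \<and>
    q \<cdot>\<^bsub>C\<^esub> f = zero_ar C (src C f) (tgt C q) \<and>
    (\<forall>X \<in> Ob C. \<forall>x \<in> Hom C (tgt C f) X. x \<cdot>\<^bsub>C\<^esub> f = zero_ar C (src C f) X \<longrightarrow>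
      (\<exists>!u. u \<in> Hom C (tgt C q) X \<and> u \<cdot>\<^bsub>C\<^esub> q = x))"

text \<open>Exactness of \<open>0 \<rightarrow> A \<rightarrow> B \<rightarrow> C \<rightarrow> 0\<close>, with maps \<open>f\<close> and \<open>g\<close>.\<close>

definition short_exact :: "('o, 'a, 'm) preadditive_cat_scheme \<Rightarrow> 'a \<Rightarrow> 'a \<Rightarrow> bool" where
  "short_exact C f g \<longleftrightarrow> is_kernel C f g \<and> is_cokernel C g f"

definition full_subcat ::
  "('o, 'a, 'm) preadditive_cat_scheme \<Rightarrow> 'o set \<Rightarrow> ('o, 'a) preadditive_cat" where
  "full_subcat C S = \<lparr>Ob = S, Ar = {f \<in> Ar C. src C f \<in> S \<and> tgt C f \<in> S},
     src = src C, tgt = tgt C, idt = idt C, comp = comp C,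
     plus_ar = plus_ar C, zero_ar = zero_ar C\<rparr>"

text \<open>
  The definition only uses the notion of short exact sequence. It is applied below to the heart
  of a t-structure; that the heart is abelian is a theorem and is not made a hypothesis.
\<close>

definition torsion_theory ::
  "('o, 'a, 'm) preadditive_cat_scheme \<Rightarrow> 'o set \<Rightarrow> 'o set \<Rightarrow> bool" where
  "torsion_theory C T F \<longleftrightarrow> strictly_full C T \<and> strictly_full C F \<and>
    (\<forall>X \<in> T. \<forall>Y \<in> F. Hom C X Y = {zero_ar C X Y}) \<and>
    (\<forall>A \<in> Ob C. \<exists>X \<in> T. \<exists>Y \<in> F. \<exists>f \<in> Hom C X A. \<exists>g \<in> Hom C A Y. short_exact C f g)"


section \<open>Triangulated categories\<close>

text \<open>
  The translation automorphism is given together with all its integer powers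
  \<open>X \<mapsto> X[n]\<close>, as a strict action of the integers by additive functors.
  A triangle \<open>X \<rightarrow> Y \<rightarrow> Z \<rightarrow> X[1]\<close> is given by its three arrows.
\<close>

record ('o, 'a) triangulated_cat = "('o, 'a) preadditive_cat" +
  sh :: "int \<Rightarrow> 'o \<Rightarrow> 'o"
  sh_ar :: "int \<Rightarrow> 'a \<Rightarrow> 'a"
  dist :: "('a \<times> 'a \<times> 'a) set"

definition is_triangle ::
  "('o, 'a, 'm) triangulated_cat_scheme \<Rightarrow> 'a \<Rightarrow> 'a \<Rightarrow> 'a \<Rightarrow> bool" where
  "is_triangle D f g h \<longleftrightarrow> f \<in> Ar D \<and> g \<in> Hom D (tgt D f) (src D h) \<and>
    h \<in> Ar D \<and> tgt D h = sh D 1 (src D f)"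

text \<open>
  \<open>triangle_map D (f, g, h) (f', g', h') a b c\<close>: the arrows \<open>a\<close>, \<open>b\<close>, \<open>c\<close> between the first,
  second and third vertices form a morphism of triangles.
\<close>

fun triangle_map ::
  "('o, 'a, 'm) triangulated_cat_scheme \<Rightarrow> 'a \<times> 'a \<times> 'a \<Rightarrow> 'a \<times> 'a \<times> 'a \<Rightarrow>
    'a \<Rightarrow> 'a \<Rightarrow> 'a \<Rightarrow> bool" where
  "triangle_map D (f, g, h) (f', g', h') a b c \<longleftrightarrow>
     a \<in> Hom D (src D f) (src D f') \<and> b \<in> Hom D (src D g) (src D g') \<and>
     c \<in> Hom D (src D h) (src D h') \<and>
     b \<cdot>\<^bsub>D\<^esub> f = f' \<cdot>\<^bsub>D\<^esub> a \<and> c \<cdot>\<^bsub>D\<^esub> g = g' \<cdot>\<^bsub>D\<^esub> b \<and> sh_ar D 1 a \<cdot>\<^bsub>D\<^esub> h = h' \<cdot>\<^bsub>D\<^esub> c"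

locale triangulated_category = additive_category D
  for D :: "('o, 'a, 'm) triangulated_cat_scheme" (structure) +
  assumes sh_Ob: "X \<in> Ob D \<Longrightarrow> sh D n X \<in> Ob D"
    and sh_Hom: "f \<in> Hom D X Y \<Longrightarrow> sh_ar D n f \<in> Hom D (sh D n X) (sh D n Y)"
    and sh_idt: "X \<in> Ob D \<Longrightarrow> sh_ar D n (idt D X) = idt D (sh D n X)"
    and sh_comp: "\<lbrakk>f \<in> Hom D X Y; g \<in> Hom D Y Z\<rbrakk> \<Longrightarrow>
      sh_ar D n (g \<cdot> f) = sh_ar D n g \<cdot> sh_ar D n f"
    and sh_plus: "\<lbrakk>f \<in> Hom D X Y; g \<in> Hom D X Y\<rbrakk> \<Longrightarrow>
      sh_ar D n (plus_ar D f g) = plus_ar D (sh_ar D n f) (sh_ar D n g)"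
    and sh_0: "X \<in> Ob D \<Longrightarrow> sh D 0 X = X"
    and sh_ar_0: "f \<in> Ar D \<Longrightarrow> sh_ar D 0 f = f"
    and sh_add: "X \<in> Ob D \<Longrightarrow> sh D (m + n) X = sh D m (sh D n X)"
    and sh_ar_add: "f \<in> Ar D \<Longrightarrow> sh_ar D (m + n) f = sh_ar D m (sh_ar D n f)"
    and dist_triangle: "(f, g, h) \<in> dist D \<Longrightarrow> is_triangle D f g h"
    and TR1_iso: "\<lbrakk>(f, g, h) \<in> dist D; is_triangle D f' g' h';
      triangle_map D (f, g, h) (f', g', h') a b c; is_iso D a; is_iso D b; is_iso D c\<rbrakk>
      \<Longrightarrow> (f', g', h') \<in> dist D"
    and TR1_idt: "\<lbrakk>X \<in> Ob D; is_zero_object D Z\<rbrakk>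
      \<Longrightarrow> (idt D X, zero_ar D X Z, zero_ar D Z (sh D 1 X)) \<in> dist D"
    and TR1_cone: "f \<in> Ar D \<Longrightarrow> \<exists>g h. (f, g, h) \<in> dist D"
    and TR2: "is_triangle D f g h \<Longrightarrow>
      (f, g, h) \<in> dist D \<longleftrightarrow> (g, h, neg_ar D (sh_ar D 1 f)) \<in> dist D"
    and TR3: "\<lbrakk>(f, g, h) \<in> dist D; (f', g', h') \<in> dist D;
      a \<in> Hom D (src D f) (src D f'); b \<in> Hom D (tgt D f) (tgt D f'); b \<cdot> f = f' \<cdot> a\<rbrakk>
      \<Longrightarrow> \<exists>c. triangle_map D (f, g, h) (f', g', h') a b c"
    and TR4: "\<lbrakk>tgt D f = src D g;
      (f, f', f'') \<in> dist D; (g, g', g'') \<in> dist D; (g \<cdot> f, k', k'') \<in> dist D\<rbrakk>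
      \<Longrightarrow> \<exists>u v. u \<in> Hom D (tgt D f') (tgt D k') \<and> v \<in> Hom D (tgt D k') (tgt D g') \<and>
        (u, v, sh_ar D 1 f' \<cdot> g'') \<in> dist D \<and>
        u \<cdot> f' = k' \<cdot> g \<and> k'' \<cdot> u = f'' \<and> v \<cdot> k' = g' \<and> g'' \<cdot> v = sh_ar D 1 f \<cdot> k''"


section \<open>t-structures\<close>

text \<open>
  \<open>shifted D S n\<close> is \<open>S[-n]\<close>, so \<open>D\<^sup>\<le>\<^sup>n\<close> is \<open>shifted D Dle n\<close> and \<open>D\<^sup>\<ge>\<^sup>n\<close> is \<open>shifted D Dge n\<close>.
\<close>

definition shifted :: "('o, 'a, 'm) triangulated_cat_scheme \<Rightarrow> 'o set \<Rightarrow> int \<Rightarrow> 'o set" where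
  "shifted D S n = sh D (- n) ` S"

locale t_structure = triangulated_category D
  for D :: "('o, 'a, 'm) triangulated_cat_scheme" (structure) and Dle Dge :: "'o set" +
  assumes Dle_strictly_full: "strictly_full D Dle"
    and Dge_strictly_full: "strictly_full D Dge"
    and Hom_vanish: "\<lbrakk>X \<in> Dle; Y \<in> shifted D Dge 1\<rbrakk> \<Longrightarrow> Hom D X Y = {zero_ar D X Y}"
    and Dle_mono: "Dle \<subseteq> shifted D Dle 1"
    and Dge_antimono: "shifted D Dge 1 \<subseteq> Dge"
    and ex_truncation: "X \<in> Ob D \<Longrightarrow>
      \<exists>A \<in> Dle. \<exists>B \<in> shifted D Dge 1. \<exists>f \<in> Hom D A X. \<exists>g \<in> Hom D X B. \<exists>h. (f, g, h) \<in> dist D"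

definition heart ::
  "('o, 'a, 'm) triangulated_cat_scheme \<Rightarrow> 'o set \<Rightarrow> 'o set \<Rightarrow> ('o, 'a) preadditive_cat" where
  "heart D Dle Dge = full_subcat D (Dle \<inter> Dge)"

text \<open>
  Object parts of the truncation and cohomology functors. Truncations are adjoints to the
  inclusions of \<open>D\<^sup>\<le>\<^sup>n\<close> and \<open>D\<^sup>\<ge>\<^sup>n\<close>, hence determined up to unique isomorphism; the choice operator
  fixes a representative.
\<close>

definition trunc_le ::
  "('o, 'a, 'm) triangulated_cat_scheme \<Rightarrow> 'o set \<Rightarrow> int \<Rightarrow> 'o \<Rightarrow> 'o" where
  "trunc_le D Dle n X = (SOME A. \<exists>e. is_coreflection D (shifted D Dle n) X A e)"

definition trunc_ge ::
  "('o, 'a, 'm) triangulated_cat_scheme \<Rightarrow> 'o set \<Rightarrow> int \<Rightarrow> 'o \<Rightarrow> 'o" where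
  "trunc_ge D Dge n X = (SOME A. \<exists>e. is_reflection D (shifted D Dge n) X A e)"

definition cohom ::
  "('o, 'a, 'm) triangulated_cat_scheme \<Rightarrow> 'o set \<Rightarrow> 'o set \<Rightarrow> int \<Rightarrow> 'o \<Rightarrow> 'o" where
  "cohom D Dle Dge i X = trunc_ge D Dge 0 (trunc_le D Dle 0 (sh D i X))"

end

theory Submission
  imports Defs
begin

text \<open>
  Every condition is expressed by vanishing of Hom groups. Both halves of a t-structure are each
  other's orthogonals, and a torsion theory is determined by orthogonality in the same way. Since
  \<open>H\<^sup>1(A)\<close> is the reflection of \<open>A[1]\<close> into \<open>D\<^sup>\<ge>\<^sup>0\<close> when \<open>A \<in> D\<^sup>\<le>\<^sup>1\<close>, the condition \<open>H\<^sup>1(A) \<in> T\<close> says that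
  \<open>Hom(A[1], Y) = 0\<close> for all \<open>Y \<in> F\<close>; dually, for \<open>A \<in> D\<^sup>\<ge>\<^sup>0\<close>, \<open>H\<^sup>0(A) \<in> F\<close> says that \<open>Hom(X, A) = 0\<close>
  for all \<open>X \<in> T\<close>. With these descriptions only the truncation triangles need an argument. Given \<open>X\<close>,
  let \<open>P\<close> be its truncation in \<open>D\<^sup>\<le>\<^sup>0\<close> and \<open>Y \<in> F\<close> the torsion-free quotient of \<open>H\<^sup>0(X) = H\<^sup>0(P)\<close>; the fibre \<open>A\<close>
  of \<open>P \<rightarrow> Y\<close> and the cone of \<open>A \<rightarrow> P \<rightarrow> X\<close> are controlled by applying the octahedral axiom twice.
\<close>

section \<open>Orthogonality in additive categories\<close>

lemma HomD:
  assumes "f \<in> Hom C X Y"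
  shows "f \<in> Ar C" "src C f = X" "tgt C f = Y"
  using assms by (auto simp: Hom_def)

context category
begin

lemma Hom_Ob:
  assumes "f \<in> Hom C X Y"
  shows "X \<in> Ob C" "Y \<in> Ob C"
  using assms src_Ob tgt_Ob by (auto simp: Hom_def)

lemma isomorphicI:
  assumes "f \<in> Hom C X Y" "g \<in> Hom C Y X" "g \<cdot> f = idt C X" "f \<cdot> g = idt C Y"
  shows "isomorphic C X Y"
  unfolding isomorphic_def is_iso_def using assms by (auto simp: Hom_def)

lemma isomorphicE:
  assumes "isomorphic C X Y"
  obtains f g where "f \<in> Hom C X Y" "g \<in> Hom C Y X" "g \<cdot> f = idt C X" "f \<cdot> g = idt C Y"
  using assms unfolding isomorphic_def is_iso_def by (auto simp: Hom_def)

lemma isomorphic_sym: "isomorphic C X Y \<Longrightarrow> isomorphic C Y X"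
  by (meson isomorphicE isomorphicI)

lemma isomorphicI_left_right:
  assumes f: "f \<in> Hom C X Y" and g: "g \<in> Hom C Y X" "g \<cdot> f = idt C X"
    and h: "h \<in> Hom C Y X" "f \<cdot> h = idt C Y"
  shows "isomorphic C X Y"
proof -
  have "h = (g \<cdot> f) \<cdot> h"
    using g h comp_idt_left[OF h(1)] by simp
  also have "\<dots> = g"
    using comp_assoc[OF h(1) f g(1)] h(2) comp_idt_right[OF g(1)] by simp
  finally show ?thesis
    using isomorphicI f g h by simp
qed

lemma coreflection_isomorphic:
  assumes e: "is_coreflection C S X A e" and X: "X \<in> S" "X \<in> Ob C"
  shows "isomorphic C A X"
proof -
  have A: "A \<in> S" "e \<in> Hom C A X"
    and u: "\<And>B f. \<lbrakk>B \<in> S; f \<in> Hom C B X\<rbrakk> \<Longrightarrow> \<exists>!g. g \<in> Hom C B A \<and> e \<cdot> g = f"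
    using e unfolding is_coreflection_def by auto
  obtain g where g: "g \<in> Hom C X A" "e \<cdot> g = idt C X"
    using u[OF X(1) idt_Hom[OF X(2)]] by blast
  have "e \<cdot> (g \<cdot> e) = e"
    using comp_assoc[OF A(2) g(1) A(2)] g(2) comp_idt_left[OF A(2)] by simp
  moreover have "e \<cdot> idt C A = e" "idt C A \<in> Hom C A A" "g \<cdot> e \<in> Hom C A A"
    using A g comp_idt_right comp_Hom idt_Hom Hom_Ob by blast+
  ultimately have "g \<cdot> e = idt C A"
    using u[OF A] by blast
  then show ?thesis
    using isomorphicI A g by blast
qed

lemma reflection_isomorphic:
  assumes e: "is_reflection C S X A e" and X: "X \<in> S" "X \<in> Ob C"
  shows "isomorphic C X A"
proof -
  have A: "A \<in> S" "e \<in> Hom C X A"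
    and u: "\<And>B f. \<lbrakk>B \<in> S; f \<in> Hom C X B\<rbrakk> \<Longrightarrow> \<exists>!g. g \<in> Hom C A B \<and> g \<cdot> e = f"
    using e unfolding is_reflection_def by auto
  obtain g where g: "g \<in> Hom C A X" "g \<cdot> e = idt C X"
    using u[OF X(1) idt_Hom[OF X(2)]] by blast
  have "(e \<cdot> g) \<cdot> e = e"
    using comp_assoc[OF A(2) g(1) A(2)] g(2) comp_idt_right[OF A(2)] by simp
  moreover have "idt C A \<cdot> e = e" "idt C A \<in> Hom C A A" "e \<cdot> g \<in> Hom C A A"
    using A g comp_idt_left comp_Hom idt_Hom Hom_Ob by blast+
  ultimately have "e \<cdot> g = idt C A"
    using u[OF A] by blast
  then show ?thesis
    using isomorphicI A g by blast
qed

end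

section \<open>Arithmetic of arrows in an additive category\<close>

context additive_category
begin

lemma zero_Hom:
  assumes "X \<in> Ob C" "Y \<in> Ob C"
  shows "zero_ar C X Y \<in> Hom C X Y"
proof -
  interpret G: comm_group "Hom_group C X Y"
    using Hom_comm_group assms .
  show ?thesis
    using G.one_closed by (simp add: Hom_group_def)
qed

lemma neg_Hom:
  assumes "f \<in> Hom C X Y"
  shows "neg_ar C f \<in> Hom C X Y"
proof -
  interpret G: comm_group "Hom_group C X Y"
    using Hom_comm_group Hom_Ob assms by blast
  show ?thesis
    using G.inv_closed[of f] assms by (simp add: Hom_group_def neg_ar_def HomD[OF assms])
qed

lemma plus_Hom:
  assumes "f \<in> Hom C X Y" "g \<in> Hom C X Y"
  shows "plus_ar C f g \<in> Hom C X Y"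
proof -
  interpret G: comm_group "Hom_group C X Y"
    using Hom_comm_group Hom_Ob assms by blast
  show ?thesis
    using G.m_closed[of f g] assms by (simp add: Hom_group_def)
qed

lemma plus_neg:
  assumes "f \<in> Hom C X Y"
  shows "plus_ar C f (neg_ar C f) = zero_ar C X Y"
proof -
  interpret G: comm_group "Hom_group C X Y"
    using Hom_comm_group Hom_Ob assms by blast
  show ?thesis
    using G.r_inv[of f] assms by (simp add: Hom_group_def neg_ar_def HomD[OF assms])
qed

lemma neg_unique:
  assumes "f \<in> Hom C X Y" "g \<in> Hom C X Y" "plus_ar C f g = zero_ar C X Y"
  shows "neg_ar C f = g"
proof -
  interpret G: comm_group "Hom_group C X Y"
    using Hom_comm_group Hom_Ob assms(1) by blast
  have "plus_ar C g f = plus_ar C f g"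
    using G.m_comm[of g f] assms by (simp add: Hom_group_def)
  then show ?thesis
    using G.inv_equality[of g f] assms by (simp add: Hom_group_def neg_ar_def HomD[OF assms(1)])
qed

text \<open>An additive map sends zero to an element equal to its own double. Cancelling once shows
  that composition and translation preserve zero arrows.\<close>

lemma idempotent_zero:
  assumes "f \<in> Hom C X Y" "plus_ar C f f = f"
  shows "f = zero_ar C X Y"
proof -
  interpret G: comm_group "Hom_group C X Y"
    using Hom_comm_group Hom_Ob assms(1) by blast
  show ?thesis
    using G.l_cancel_one[of f f] assms by (simp add: Hom_group_def)
qed

lemma zero_plus_zero:
  assumes "X \<in> Ob C" "Y \<in> Ob C"
  shows "plus_ar C (zero_ar C X Y) (zero_ar C X Y) = zero_ar C X Y"
proof -
  interpret G: comm_group "Hom_group C X Y"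
    using Hom_comm_group assms .
  show ?thesis
    using G.l_one[OF G.one_closed] by (simp add: Hom_group_def)
qed

lemma neg_neg:
  assumes "f \<in> Hom C X Y"
  shows "neg_ar C (neg_ar C f) = f"
proof -
  interpret G: comm_group "Hom_group C X Y"
    using Hom_comm_group Hom_Ob assms by blast
  show ?thesis
    using G.inv_inv[of f] assms HomD[OF neg_Hom[OF assms]] HomD[OF assms]
    by (simp add: Hom_group_def neg_ar_def)
qed

lemma diff_zeroD:
  assumes "f \<in> Hom C X Y" "g \<in> Hom C X Y" "plus_ar C f (neg_ar C g) = zero_ar C X Y"
  shows "f = g"
  using neg_unique[OF assms(1) neg_Hom[OF assms(2)] assms(3)] neg_neg assms(1,2) by metis

lemma comp_zero_right:
  assumes "g \<in> Hom C Y Z" "X \<in> Ob C"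
  shows "g \<cdot> zero_ar C X Y = zero_ar C X Z"
proof (rule idempotent_zero)
  have z: "zero_ar C X Y \<in> Hom C X Y"
    using assms zero_Hom Hom_Ob by blast
  then show "g \<cdot> zero_ar C X Y \<in> Hom C X Z"
    using assms comp_Hom by blast
  show "plus_ar C (g \<cdot> zero_ar C X Y) (g \<cdot> zero_ar C X Y) = g \<cdot> zero_ar C X Y"
    using comp_plus_right[OF z z assms(1)] zero_plus_zero Hom_Ob z by simp
qed

lemma comp_zero_left:
  assumes "f \<in> Hom C X Y" "Z \<in> Ob C"
  shows "zero_ar C Y Z \<cdot> f = zero_ar C X Z"
proof (rule idempotent_zero)
  have z: "zero_ar C Y Z \<in> Hom C Y Z"
    using assms zero_Hom Hom_Ob by blast
  then show "zero_ar C Y Z \<cdot> f \<in> Hom C X Z"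
    using assms comp_Hom by blast
  show "plus_ar C (zero_ar C Y Z \<cdot> f) (zero_ar C Y Z \<cdot> f) = zero_ar C Y Z \<cdot> f"
    using comp_plus_left[OF assms(1) z z] zero_plus_zero Hom_Ob z by simp
qed

lemma comp_neg_right:
  assumes "f \<in> Hom C X Y" "g \<in> Hom C Y Z"
  shows "g \<cdot> neg_ar C f = neg_ar C (g \<cdot> f)"
proof (rule neg_unique[symmetric])
  show "g \<cdot> f \<in> Hom C X Z" "g \<cdot> neg_ar C f \<in> Hom C X Z"
    using assms neg_Hom comp_Hom by blast+
  show "plus_ar C (g \<cdot> f) (g \<cdot> neg_ar C f) = zero_ar C X Z"
    using comp_plus_right[OF assms(1) neg_Hom[OF assms(1)] assms(2)] plus_neg[OF assms(1)]
      comp_zero_right[OF assms(2)] Hom_Ob[OF assms(1)] by simp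
qed

lemma comp_neg_left:
  assumes "f \<in> Hom C X Y" "g \<in> Hom C Y Z"
  shows "neg_ar C g \<cdot> f = neg_ar C (g \<cdot> f)"
proof (rule neg_unique[symmetric])
  show "g \<cdot> f \<in> Hom C X Z" "neg_ar C g \<cdot> f \<in> Hom C X Z"
    using assms neg_Hom comp_Hom by blast+
  show "plus_ar C (g \<cdot> f) (neg_ar C g \<cdot> f) = zero_ar C X Z"
    using comp_plus_left[OF assms(1,2) neg_Hom[OF assms(2)]] plus_neg[OF assms(2)]
      comp_zero_left[OF assms(1)] Hom_Ob[OF assms(2)] by simp
qed

text \<open>Passing to the difference of \<open>u\<close> and \<open>v\<close> reduces uniqueness of
  a factorisation to the vanishing of arrows killed by \<open>f\<close>.\<close>

lemma cancel_right:
  assumes "u \<in> Hom C Y Z" "v \<in> Hom C Y Z" "f \<in> Hom C X Y" "u \<cdot> f = v \<cdot> f"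
    and "\<And>w. \<lbrakk>w \<in> Hom C Y Z; w \<cdot> f = zero_ar C X Z\<rbrakk> \<Longrightarrow> w = zero_ar C Y Z"
  shows "u = v"
proof (rule diff_zeroD[OF assms(1,2)], rule assms(5))
  show "plus_ar C u (neg_ar C v) \<in> Hom C Y Z"
    using assms plus_Hom neg_Hom by blast
  show "plus_ar C u (neg_ar C v) \<cdot> f = zero_ar C X Z"
    using comp_plus_left[OF assms(3,1) neg_Hom[OF assms(2)]] comp_neg_left[OF assms(3,2)]
      plus_neg[OF comp_Hom[OF assms(3,2)]] assms(4) by simp
qed

lemma cancel_left:
  assumes "u \<in> Hom C X Y" "v \<in> Hom C X Y" "f \<in> Hom C Y Z" "f \<cdot> u = f \<cdot> v"
    and "\<And>w. \<lbrakk>w \<in> Hom C X Y; f \<cdot> w = zero_ar C X Z\<rbrakk> \<Longrightarrow> w = zero_ar C X Y"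
  shows "u = v"
proof (rule diff_zeroD[OF assms(1,2)], rule assms(5))
  show "plus_ar C u (neg_ar C v) \<in> Hom C X Y"
    using assms plus_Hom neg_Hom by blast
  show "f \<cdot> plus_ar C u (neg_ar C v) = zero_ar C X Z"
    using comp_plus_right[OF assms(1) neg_Hom[OF assms(2)] assms(3)] comp_neg_right[OF assms(2,3)]
      plus_neg[OF comp_Hom[OF assms(2,3)]] assms(4) by simp
qed

section \<open>Vanishing of Hom groups\<close>

definition orth :: "'o \<Rightarrow> 'o \<Rightarrow> bool" where
  "orth X Y \<longleftrightarrow> (\<forall>f \<in> Hom C X Y. f = zero_ar C X Y)"

lemma orthD: "orth X Y \<Longrightarrow> f \<in> Hom C X Y \<Longrightarrow> f = zero_ar C X Y"
  by (simp add: orth_def)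

lemma Hom_eq_zero_iff_orth:
  assumes "X \<in> Ob C" "Y \<in> Ob C"
  shows "Hom C X Y = {zero_ar C X Y} \<longleftrightarrow> orth X Y"
  using zero_Hom[OF assms] by (auto simp: orth_def)

text \<open>An arrow out of a retract \<open>A\<close> of \<open>B\<close> factors through
  \<open>B\<close>. Isomorphic objects are retracts of each other, which gives invariance under
  isomorphism.\<close>

lemma orth_retract_left:
  assumes "orth B Y" and f: "f \<in> Hom C A B" "g \<in> Hom C B A" "g \<cdot> f = idt C A"
  shows "orth A Y"
  unfolding orth_def
proof
  fix x assume x: "x \<in> Hom C A Y"
  have "x = (x \<cdot> g) \<cdot> f"
    using comp_assoc[OF f(1,2) x] f(3) comp_idt_right[OF x] by simp
  also have "x \<cdot> g = zero_ar C B Y"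
    using orthD[OF assms(1) comp_Hom[OF f(2) x]] .
  also have "\<dots> \<cdot> f = zero_ar C A Y"
    using comp_zero_left[OF f(1)] Hom_Ob[OF x] by simp
  finally show "x = zero_ar C A Y" .
qed

lemma orth_retract_right:
  assumes "orth X B" and f: "f \<in> Hom C A B" "g \<in> Hom C B A" "g \<cdot> f = idt C A"
  shows "orth X A"
  unfolding orth_def
proof
  fix x assume x: "x \<in> Hom C X A"
  have "x = g \<cdot> (f \<cdot> x)"
    using comp_assoc[OF x f(1,2)] f(3) comp_idt_left[OF x] by simp
  also have "f \<cdot> x = zero_ar C X B"
    using orthD[OF assms(1) comp_Hom[OF x f(1)]] .
  also have "g \<cdot> \<dots> = zero_ar C X A"
    using comp_zero_right[OF f(2)] Hom_Ob[OF x] by simp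
  finally show "x = zero_ar C X A" .
qed

lemma orth_isomorphic_left: "isomorphic C A B \<Longrightarrow> orth A Y \<longleftrightarrow> orth B Y"
  by (metis isomorphicE orth_retract_left)

lemma orth_isomorphic_right: "isomorphic C A B \<Longrightarrow> orth X A \<longleftrightarrow> orth X B"
  by (metis isomorphicE orth_retract_right)

end

section \<open>Triangles\<close>

context triangulated_category
begin

definition tri :: "'o \<Rightarrow> 'o \<Rightarrow> 'o \<Rightarrow> 'a \<Rightarrow> 'a \<Rightarrow> 'a \<Rightarrow> bool" where
  "tri X Y Z f g h \<longleftrightarrow>
    f \<in> Hom D X Y \<and> g \<in> Hom D Y Z \<and> h \<in> Hom D Z (sh D 1 X) \<and> (f, g, h) \<in> dist D"

lemma triD:
  assumes "tri X Y Z f g h"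
  shows "f \<in> Hom D X Y" "g \<in> Hom D Y Z" "h \<in> Hom D Z (sh D 1 X)" "(f, g, h) \<in> dist D"
    "X \<in> Ob D" "Y \<in> Ob D" "Z \<in> Ob D"
  using assms Hom_Ob by (auto simp: tri_def)

lemma triI:
  assumes "(f, g, h) \<in> dist D" "f \<in> Hom D X Y" "g \<in> Hom D Y Z"
  shows "tri X Y Z f g h"
  using dist_triangle[OF assms(1)] assms by (auto simp: tri_def is_triangle_def Hom_def)

lemma is_triangleI:
  assumes "f \<in> Hom D X Y" "g \<in> Hom D Y Z" "h \<in> Hom D Z (sh D 1 X)"
  shows "is_triangle D f g h"
  using assms by (auto simp: is_triangle_def Hom_def)

lemma ex_cone:
  assumes "f \<in> Hom D X Y"
  obtains Z g h where "tri X Y Z f g h"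
proof -
  obtain g h where d: "(f, g, h) \<in> dist D"
    using TR1_cone HomD(1)[OF assms] by blast
  then have "g \<in> Hom D Y (src D h)"
    using dist_triangle HomD[OF assms] by (auto simp: is_triangle_def)
  then show thesis
    using that triI d assms by blast
qed

section \<open>Translation and rotation\<close>

lemma sh_sh: "X \<in> Ob D \<Longrightarrow> sh D m (sh D n X) = sh D (m + n) X"
  by (simp add: sh_add)

lemma sh_ar_sh_ar: "f \<in> Hom D X Y \<Longrightarrow> sh_ar D m (sh_ar D n f) = sh_ar D (m + n) f"
  by (simp add: sh_ar_add HomD(1))

lemma sh_ar_id: "f \<in> Hom D X Y \<Longrightarrow> sh_ar D 0 f = f"
  by (simp add: sh_ar_0 HomD(1))

lemma sh_ar_zero:
  assumes "X \<in> Ob D" "Y \<in> Ob D"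
  shows "sh_ar D n (zero_ar D X Y) = zero_ar D (sh D n X) (sh D n Y)"
proof (rule idempotent_zero)
  have z: "zero_ar D X Y \<in> Hom D X Y"
    using zero_Hom assms by blast
  then show "sh_ar D n (zero_ar D X Y) \<in> Hom D (sh D n X) (sh D n Y)"
    using sh_Hom by blast
  show "plus_ar D (sh_ar D n (zero_ar D X Y)) (sh_ar D n (zero_ar D X Y))
      = sh_ar D n (zero_ar D X Y)"
    using sh_plus[OF z z, of n] zero_plus_zero[OF assms] by simp
qed

lemma sh_ar_neg:
  assumes "f \<in> Hom D X Y"
  shows "sh_ar D n (neg_ar D f) = neg_ar D (sh_ar D n f)"
proof (rule neg_unique[symmetric])
  show "sh_ar D n f \<in> Hom D (sh D n X) (sh D n Y)"
    "sh_ar D n (neg_ar D f) \<in> Hom D (sh D n X) (sh D n Y)"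
    using assms neg_Hom sh_Hom by blast+
  show "plus_ar D (sh_ar D n f) (sh_ar D n (neg_ar D f)) = zero_ar D (sh D n X) (sh D n Y)"
    using sh_plus[OF assms neg_Hom[OF assms], of n] plus_neg[OF assms] sh_ar_zero Hom_Ob[OF assms]
    by simp
qed

lemma isomorphic_sh:
  assumes "isomorphic D X Y"
  shows "isomorphic D (sh D n X) (sh D n Y)"
proof -
  obtain f g where fg: "f \<in> Hom D X Y" "g \<in> Hom D Y X" "g \<cdot> f = idt D X" "f \<cdot> g = idt D Y"
    using isomorphicE[OF assms] .
  then show ?thesis
    using isomorphicI[OF sh_Hom sh_Hom] sh_comp sh_idt Hom_Ob[OF fg(1)] by metis
qed

lemma orth_sh:
  assumes "X \<in> Ob D" "Y \<in> Ob D"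
  shows "orth (sh D n X) (sh D n Y) \<longleftrightarrow> orth X Y"
proof -
  have *: "orth A B" if o: "orth (sh D k A) (sh D k B)" and A: "A \<in> Ob D" "B \<in> Ob D" for k A B
    unfolding orth_def
  proof
    fix f assume f: "f \<in> Hom D A B"
    have "f = sh_ar D (- k) (sh_ar D k f)"
      using sh_ar_sh_ar[OF f] sh_ar_id[OF f] by simp
    also have "sh_ar D k f = zero_ar D (sh D k A) (sh D k B)"
      using orthD[OF o sh_Hom[OF f]] .
    also have "sh_ar D (- k) \<dots> = zero_ar D A B"
      using sh_ar_zero[OF sh_Ob[OF A(1)] sh_Ob[OF A(2)]] A by (simp add: sh_sh sh_0)
    finally show "f = zero_ar D A B" .
  qed
  have "orth (sh D n X) (sh D n Y)" if "orth X Y"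
    using *[of "- n" "sh D n X" "sh D n Y"] that assms by (simp add: sh_sh sh_0 sh_Ob)
  then show ?thesis
    using *[OF _ assms] by blast
qed

lemma orth_sh_left:
  assumes "X \<in> Ob D" "Y \<in> Ob D"
  shows "orth (sh D n X) Y \<longleftrightarrow> orth X (sh D (- n) Y)"
  using orth_sh[of X "sh D (- n) Y" n] assms by (simp add: sh_sh sh_0 sh_Ob)

lemma tri_rotate:
  assumes "tri X Y Z f g h"
  shows "tri Y Z (sh D 1 X) g h (neg_ar D (sh_ar D 1 f))"
  using TR2[OF is_triangleI[OF triD(1-3)[OF assms]]] triD[OF assms] triI by blast

text \<open>\<open>TR2\<close> is read from right to left. The sign on the first arrow is chosen so
  that rotating forward negates twice and returns \<open>h\<close>.\<close>

lemma tri_rotate_back: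
  assumes "tri X Y Z f g h"
  shows "tri (sh D (- 1) Z) X Y (neg_ar D (sh_ar D (- 1) h)) f g"
proof -
  note t = triD[OF assms]
  let ?h = "sh_ar D (- 1) h"
  have h: "?h \<in> Hom D (sh D (- 1) Z) X"
    using sh_Hom[OF t(3), of "- 1"] t(5) by (simp add: sh_sh sh_0)
  have g: "g \<in> Hom D Y (sh D 1 (sh D (- 1) Z))"
    using t by (simp add: sh_sh sh_0)
  have "neg_ar D (sh_ar D 1 (neg_ar D ?h)) = h"
    using sh_ar_neg[OF h, of 1] neg_neg[OF t(3)] sh_ar_sh_ar[OF t(3), of 1 "- 1"]
      sh_ar_id[OF t(3)] by simp
  then have "(neg_ar D ?h, f, g) \<in> dist D"
    using TR2[OF is_triangleI[OF neg_Hom[OF h] t(1) g]] t(4) by simp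
  then show ?thesis
    using triI neg_Hom[OF h] t(1) by blast
qed

text \<open>Three rotations translate all vertices. The arrows are forgotten, along with their
  signs, because only the vertices matter later.\<close>

lemma tri_sh:
  assumes "tri X Y Z f g h"
  obtains f' g' h' where "tri (sh D 1 X) (sh D 1 Y) (sh D 1 Z) f' g' h'"
  using tri_rotate[OF tri_rotate[OF tri_rotate[OF assms]]] by blast

lemma tri_sh_back:
  assumes "tri X Y Z f g h"
  obtains f' g' h' where "tri (sh D (- 1) X) (sh D (- 1) Y) (sh D (- 1) Z) f' g' h'"
  using tri_rotate_back[OF tri_rotate_back[OF tri_rotate_back[OF assms]]] by blast

section \<open>Exactness of Hom along a triangle\<close>

lemma zero_object_Hom:
  assumes "is_zero_object D Z" "X \<in> Ob D"
  shows "orth Z X" "orth X Z"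
  using assms zero_Hom unfolding is_zero_object_def orth_def by metis+

lemma tri_morphism:
  assumes t: "tri X Y Z f g h" and t': "tri X' Y' Z' f' g' h'"
    and ab: "a \<in> Hom D X X'" "b \<in> Hom D Y Y'" "b \<cdot> f = f' \<cdot> a"
  obtains c where "c \<in> Hom D Z Z'" "c \<cdot> g = g' \<cdot> b" "sh_ar D 1 a \<cdot> h = h' \<cdot> c"
proof -
  note td = triD[OF t] and td' = triD[OF t']
  note st = HomD(2,3)[OF td(1)] HomD(2,3)[OF td'(1)] HomD(2)[OF td(3)] HomD(2)[OF td'(3)]
  have "\<exists>c. triangle_map D (f, g, h) (f', g', h') a b c"
    using TR3[OF td(4) td'(4), of a b] ab unfolding st by blast
  then show thesis
    using that unfolding triangle_map.simps st by blast
qed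

text \<open>Comparing the identity triangle \<open>X -> X -> 0\<close> with the given one makes
  \<open>g \<cdot> f\<close> factor through a zero object.\<close>

lemma tri_comp_zero:
  assumes "tri X Y Z f g h"
  shows "g \<cdot> f = zero_ar D X Z"
proof -
  note t = triD[OF assms]
  obtain V where V: "is_zero_object D V" "V \<in> Ob D"
    using ex_zero_object by (auto simp: is_zero_object_def)
  have "tri X X V (idt D X) (zero_ar D X V) (zero_ar D V (sh D 1 X))"
    using triI[OF TR1_idt[OF t(5) V(1)] idt_Hom[OF t(5)] zero_Hom[OF t(5) V(2)]] .
  then obtain c where c: "c \<in> Hom D V Z" "c \<cdot> zero_ar D X V = g \<cdot> f"
    using tri_morphism[OF _ assms idt_Hom[OF t(5)] t(1)] by blast
  then show ?thesis
    using comp_zero_right[OF c(1) t(5)] by simp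
qed

text \<open>Exactness of Hom(W, -) at the middle vertex, by comparison with the identity triangle on
  \<open>W\<close>; no uniqueness holds in general.\<close>

lemma tri_weak_kernel:
  assumes "tri X Y Z f g h" and x: "x \<in> Hom D W Y" "g \<cdot> x = zero_ar D W Z"
  obtains u where "u \<in> Hom D W X" "f \<cdot> u = x"
proof -
  note t = triD[OF assms(1)]
  have W: "W \<in> Ob D"
    using x Hom_Ob by blast
  obtain V where V: "is_zero_object D V" "V \<in> Ob D"
    using ex_zero_object by (auto simp: is_zero_object_def)
  have "tri W W V (idt D W) (zero_ar D W V) (zero_ar D V (sh D 1 W))"
    using triI[OF TR1_idt[OF W V(1)]] idt_Hom zero_Hom W V by blast
  \<comment> \<open>Rotated, the identity triangle reads \<open>W -> 0 -> W[1]\<close>, so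
    \<open>x\<close> and the zero arrow are the two given components. \<open>TR3\<close> completes
    them by an arrow \<open>W[1] -> X[1]\<close>, whose translate by -1 is the factor.\<close>
  note r = tri_rotate[OF this]
  have z: "zero_ar D V Z \<in> Hom D V Z"
    using zero_Hom V(2) t(7) by blast
  have "zero_ar D V Z \<cdot> zero_ar D W V = g \<cdot> x"
    using comp_zero_left[OF triD(1)[OF r] t(7)] x(2) by simp
  then obtain c where c: "c \<in> Hom D (sh D 1 W) (sh D 1 X)"
      "sh_ar D 1 x \<cdot> neg_ar D (sh_ar D 1 (idt D W)) = neg_ar D (sh_ar D 1 f) \<cdot> c"
    using tri_morphism[OF r tri_rotate[OF assms(1)] x(1) z] by blast
  have x1: "sh_ar D 1 x \<in> Hom D (sh D 1 W) (sh D 1 Y)"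
    and f1: "sh_ar D 1 f \<in> Hom D (sh D 1 X) (sh D 1 Y)"
    and i1: "sh_ar D 1 (idt D W) \<in> Hom D (sh D 1 W) (sh D 1 W)"
    using sh_Hom[OF x(1)] sh_Hom[OF t(1)] sh_Hom[OF idt_Hom[OF W]] by simp_all
  have "neg_ar D (sh_ar D 1 x) = neg_ar D (sh_ar D 1 f \<cdot> c)"
    using c(2) comp_neg_right[OF i1 x1] comp_neg_left[OF c(1) f1] sh_idt[OF W]
      comp_idt_right[OF x1] by simp
  then have e: "sh_ar D 1 x = sh_ar D 1 f \<cdot> c"
    using neg_neg[OF x1] neg_neg[OF comp_Hom[OF c(1) f1]] by metis
  let ?u = "sh_ar D (- 1) c"
  have u: "?u \<in> Hom D W X"
    using sh_Hom[OF c(1), of "- 1"] W t by (simp add: sh_sh sh_0)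
  have "x = sh_ar D (- 1) (sh_ar D 1 x)"
    using sh_ar_sh_ar[OF x(1), of "- 1" 1] sh_ar_id[OF x(1)] by simp
  also have "\<dots> = sh_ar D (- 1) (sh_ar D 1 f) \<cdot> ?u"
    unfolding e using sh_comp[OF c(1) f1] .
  also have "sh_ar D (- 1) (sh_ar D 1 f) = f"
    using sh_ar_sh_ar[OF t(1), of "- 1" 1] sh_ar_id[OF t(1)] by simp
  finally show thesis
    using that[OF u] by simp
qed

text \<open>Dual exactness, of Hom(-, W). The identity triangle is rotated backwards to
  \<open>V[-1] -> W -> W\<close> with \<open>V\<close> zero, so the third component from
  \<open>TR3\<close> is already the factor.\<close>

lemma tri_weak_cokernel:
  assumes "tri X Y Z f g h" and x: "x \<in> Hom D Y W" "x \<cdot> f = zero_ar D X W"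
  obtains u where "u \<in> Hom D Z W" "u \<cdot> g = x"
proof -
  note t = triD[OF assms(1)]
  have W: "W \<in> Ob D"
    using x Hom_Ob by blast
  obtain V where V: "is_zero_object D V" "V \<in> Ob D"
    using ex_zero_object by (auto simp: is_zero_object_def)
  have "tri W W V (idt D W) (zero_ar D W V) (zero_ar D V (sh D 1 W))"
    using triI[OF TR1_idt[OF W V(1)]] idt_Hom zero_Hom W V by blast
  from tri_rotate_back[OF this] obtain k where k: "tri (sh D (- 1) V) W W k (idt D W) (zero_ar D W V)"
    by blast
  note r = triD[OF k]
  have k0: "k = zero_ar D (sh D (- 1) V) W"
    using orthD[OF _ r(1)] zero_object_Hom[OF V(1) sh_Ob[OF W, of 1]]
      orth_sh_left[OF V(2) W, of "- 1"] by simp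
  let ?z = "zero_ar D X (sh D (- 1) V)"
  have z: "?z \<in> Hom D X (sh D (- 1) V)"
    using zero_Hom t r by blast
  have "x \<cdot> f = k \<cdot> ?z"
    using comp_zero_right[OF r(1) t(5)] x by simp
  then obtain c where "c \<in> Hom D Z W" "c \<cdot> g = idt D W \<cdot> x"
    using tri_morphism[OF assms(1) k z x(1)] by blast
  then show thesis
    using that comp_idt_left[OF x(1)] by simp
qed

text \<open>Left orthogonals are closed under extensions: an arrow out of the middle vertex kills
  the first one, hence factors through the third.\<close>

lemma tri_orth_left:
  assumes t: "tri X Y Z f g h" and o: "orth X W" "orth Z W" "W \<in> Ob D"
  shows "orth Y W"
  unfolding orth_def
proof
  fix x assume x: "x \<in> Hom D Y W"
  have "x \<cdot> f = zero_ar D X W"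
    using orthD o comp_Hom x triD(1)[OF t] by blast
  then obtain u where u: "u \<in> Hom D Z W" "u \<cdot> g = x"
    using tri_weak_cokernel[OF t x] by blast
  then show "x = zero_ar D Y W"
    using orthD[OF o(2) u(1)] comp_zero_left[OF triD(2)[OF t] o(3)] by simp
qed

lemma tri_orth_right:
  assumes t: "tri X Y Z f g h" and o: "orth W X" "orth W Z" "W \<in> Ob D"
  shows "orth W Y"
  unfolding orth_def
proof
  fix x assume x: "x \<in> Hom D W Y"
  have "g \<cdot> x = zero_ar D W Z"
    using orthD o comp_Hom x triD(2)[OF t] by blast
  then obtain u where u: "u \<in> Hom D W X" "f \<cdot> u = x"
    using tri_weak_kernel[OF t x] by blast
  then show "x = zero_ar D W Y"
    using orthD[OF o(1) u(1)] comp_zero_right[OF triD(1)[OF t] o(3)] by simp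
qed

text \<open>Exactness one place further along: an arrow killed by \<open>g\<close> factors through
  \<open>X[1]\<close>. With \<open>w\<close> an identity this also detects vanishing
  vertices.\<close>

lemma tri_cancel_right:
  assumes t: "tri X Y Z f g h" and o: "orth (sh D 1 X) W"
    and w: "w \<in> Hom D Z W" "w \<cdot> g = zero_ar D Y W"
  shows "w = zero_ar D Z W"
proof -
  obtain u where u: "u \<in> Hom D (sh D 1 X) W" "u \<cdot> h = w"
    using tri_weak_cokernel[OF tri_rotate[OF t] w] by blast
  then show ?thesis
    using orthD[OF o u(1)] comp_zero_left[OF triD(3)[OF t]] Hom_Ob[OF w(1)] by simp
qed

lemma tri_cancel_left:
  assumes t: "tri X Y Z f g h" and o: "orth W (sh D (- 1) Z)"
    and w: "w \<in> Hom D W X" "f \<cdot> w = zero_ar D W Y"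
  shows "w = zero_ar D W X"
proof -
  note r = tri_rotate_back[OF t]
  obtain u where u: "u \<in> Hom D W (sh D (- 1) Z)" "neg_ar D (sh_ar D (- 1) h) \<cdot> u = w"
    using tri_weak_kernel[OF r w] by blast
  then show ?thesis
    using orthD[OF o u(1)] comp_zero_right[OF triD(1)[OF r]] Hom_Ob[OF w(1)] by simp
qed

lemma orth_of_idt_zero:
  assumes "idt D Z = zero_ar D Z Z" "Z \<in> Ob D" "X \<in> Ob D"
  shows "orth Z X" "orth X Z"
  unfolding orth_def
  using comp_idt_left comp_idt_right comp_zero_left comp_zero_right assms by metis+

text \<open>Weak kernel and weak cokernel lift the identities of \<open>Y\<close> and
  \<open>X\<close> to a right and a left inverse of \<open>f\<close>. That \<open>Z\<close> is zero
  is expressed by its identity being zero.\<close>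

lemma tri_isomorphic:
  assumes t: "tri X Y Z f g h" and Z: "idt D Z = zero_ar D Z Z"
  shows "isomorphic D X Y"
proof -
  note td = triD[OF t]
  note o = orth_of_idt_zero[OF Z td(7)]
  have i: "idt D X \<in> Hom D X X" "idt D Y \<in> Hom D Y Y"
    using idt_Hom td by auto
  have "orth Y Z"
    using o td by blast
  then obtain u where u: "u \<in> Hom D Y X" "f \<cdot> u = idt D Y"
    using tri_weak_kernel[OF t i(2)] comp_idt_right[OF td(2)] orthD[OF _ td(2)] by metis
  let ?Z = "sh D (- 1) Z"
  note r = tri_rotate_back[OF t]
  have "orth ?Z X"
    using o(1) orth_sh_left[OF td(7,5), of "- 1"] td sh_Ob by simp
  then obtain v where v: "v \<in> Hom D Y X" "v \<cdot> f = idt D X"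
    using tri_weak_cokernel[OF r i(1)] comp_idt_left[OF triD(1)[OF r]] orthD[OF _ triD(1)[OF r]]
    by metis
  show ?thesis
    using isomorphicI_left_right td(1) u v by blast
qed

text \<open>Only the triangle on the three cones is kept from \<open>TR4\<close>; the commutativity
  relations are not recorded.\<close>

lemma octahedral:
  assumes "tri X Y Z' f f' f''" "tri Y Z X' g g' g''" "tri X Z Y' (g \<cdot> f) k' k''"
  obtains u v w where "tri Z' Y' X' u v w"
proof -
  note t = triD[OF assms(1)] triD[OF assms(2)] triD[OF assms(3)]
  have "tgt D f = src D g"
    using t HomD by metis
  from TR4[OF this t(4) t(11) t(18)] obtain u v where
    "u \<in> Hom D (tgt D f') (tgt D k')" "v \<in> Hom D (tgt D k') (tgt D g')"
    "(u, v, sh_ar D 1 f' \<cdot> g'') \<in> dist D"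
    by blast
  then show thesis
    using that triI HomD(3)[OF t(2)] HomD(3)[OF t(9)] HomD(3)[OF t(16)] by metis
qed

lemma shifted_iff:
  assumes "S \<subseteq> Ob D"
  shows "X \<in> shifted D S n \<longleftrightarrow> X \<in> Ob D \<and> sh D n X \<in> S"
proof
  assume "X \<in> shifted D S n"
  then show "X \<in> Ob D \<and> sh D n X \<in> S"
    using assms by (auto simp: shifted_def sh_sh sh_0 sh_Ob subset_iff)
next
  assume X: "X \<in> Ob D \<and> sh D n X \<in> S"
  then have "X = sh D (- n) (sh D n X)"
    by (simp add: sh_sh sh_0)
  then show "X \<in> shifted D S n"
    using X unfolding shifted_def by blast
qed

end

section \<open>Truncation and cohomology\<close>

context t_structure
begin

lemma Dle_Ob: "X \<in> Dle \<Longrightarrow> X \<in> Ob D"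
  using Dle_strictly_full by (auto simp: strictly_full_def)

lemma Dge_Ob: "X \<in> Dge \<Longrightarrow> X \<in> Ob D"
  using Dge_strictly_full by (auto simp: strictly_full_def)

lemma shifted_Dle_iff: "X \<in> shifted D Dle n \<longleftrightarrow> X \<in> Ob D \<and> sh D n X \<in> Dle"
  using shifted_iff Dle_Ob by blast

lemma shifted_Dge_iff: "X \<in> shifted D Dge n \<longleftrightarrow> X \<in> Ob D \<and> sh D n X \<in> Dge"
  using shifted_iff Dge_Ob by blast

lemma Dle_sh: "X \<in> Dle \<Longrightarrow> sh D 1 X \<in> Dle"
  using Dle_mono shifted_Dle_iff by blast

lemma Dge_sh_back: "X \<in> Dge \<Longrightarrow> sh D (- 1) X \<in> Dge"
  using Dge_antimono by (auto simp: shifted_def)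

lemma orth_Dle_Dge:
  assumes "X \<in> Dle" "Y \<in> Dge"
  shows "orth X (sh D (- 1) Y)"
  using Hom_vanish[OF assms(1), of "sh D (- 1) Y"] assms(2)
  by (auto simp: shifted_def orth_def)

lemma orth_sh_Dle_Dge:
  assumes "X \<in> Dle" "Y \<in> Dge"
  shows "orth (sh D 1 X) Y"
  using orth_Dle_Dge[OF assms] orth_sh_left Dle_Ob Dge_Ob assms by simp

lemma ex_tri_le_0_ge_1:
  assumes "X \<in> Ob D"
  obtains A B f g h where "A \<in> Dle" "B \<in> Dge" "tri A X (sh D (- 1) B) f g h"
  using ex_truncation[OF assms] triI by (fastforce simp: shifted_def)

text \<open>The truncation triangle of \<open>X[-1]\<close>, translated by one. Objects of negative
  degree are written \<open>A[1]\<close> with \<open>A\<close> in \<open>Dle\<close>, and those of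
  degree at least one \<open>B[-1]\<close> with \<open>B\<close> in \<open>Dge\<close>.\<close>

lemma ex_tri_lt_0_ge_0:
  assumes "X \<in> Ob D"
  obtains A B f g h where "A \<in> Dle" "B \<in> Dge" "tri (sh D 1 A) X B f g h"
proof -
  obtain A B f g h where AB: "A \<in> Dle" "B \<in> Dge" "tri A (sh D (- 1) X) (sh D (- 1) B) f g h"
    using ex_tri_le_0_ge_1 sh_Ob assms by blast
  show thesis
    using tri_sh[OF AB(3)] that[OF AB(1,2)] assms Dge_Ob[OF AB(2)] by (auto simp: sh_sh sh_0)
qed

text \<open>If \<open>X\<close> is orthogonal to degrees at least one, the second arrow of its
  truncation triangle is zero. Then the identity of the third vertex factors through
  \<open>A[1]\<close>, which has no nonzero arrow to it, so that vertex is zero and \<open>X\<close>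
  is isomorphic to \<open>A\<close>.\<close>

lemma Dle_iff_orth: "X \<in> Dle \<longleftrightarrow> X \<in> Ob D \<and> (\<forall>Y \<in> Dge. orth (sh D 1 X) Y)"
proof
  assume "X \<in> Dle"
  then show "X \<in> Ob D \<and> (\<forall>Y \<in> Dge. orth (sh D 1 X) Y)"
    using Dle_Ob orth_sh_Dle_Dge by blast
next
  assume X: "X \<in> Ob D \<and> (\<forall>Y \<in> Dge. orth (sh D 1 X) Y)"
  then obtain A B f g h where AB: "A \<in> Dle" "B \<in> Dge" and t: "tri A X (sh D (- 1) B) f g h"
    using ex_tri_le_0_ge_1 by blast
  let ?B = "sh D (- 1) B"
  note td = triD[OF t]
  have "orth X ?B"
    using X AB orth_sh_left[of X B 1] Dge_Ob by simp
  then have "g = zero_ar D X ?B"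
    using orthD td by blast
  then have "idt D ?B = zero_ar D ?B ?B"
    using tri_cancel_right[OF t orth_Dle_Dge[OF Dle_sh[OF AB(1)] AB(2)] idt_Hom[OF td(7)]]
      comp_idt_left[OF td(2)] by simp
  then show "X \<in> Dle"
    using tri_isomorphic[OF t] Dle_strictly_full AB X by (auto simp: strictly_full_def)
qed

lemma Dge_iff_orth: "Y \<in> Dge \<longleftrightarrow> Y \<in> Ob D \<and> (\<forall>X \<in> Dle. orth (sh D 1 X) Y)"
proof
  assume "Y \<in> Dge"
  then show "Y \<in> Ob D \<and> (\<forall>X \<in> Dle. orth (sh D 1 X) Y)"
    using Dge_Ob orth_sh_Dle_Dge by blast
next
  assume Y: "Y \<in> Ob D \<and> (\<forall>X \<in> Dle. orth (sh D 1 X) Y)"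
  then obtain A B f g h where AB: "A \<in> Dle" "B \<in> Dge" and t: "tri (sh D 1 A) Y B f g h"
    using ex_tri_lt_0_ge_0 by blast
  let ?A = "sh D 1 A"
  note td = triD[OF t]
  have "f = zero_ar D ?A Y"
    using Y AB orthD td by blast
  then have "idt D ?A = zero_ar D ?A ?A"
    using tri_cancel_left[OF t orth_Dle_Dge[OF Dle_sh[OF AB(1)] AB(2)] idt_Hom[OF td(5)]]
      comp_idt_right[OF td(1)] by simp
  \<comment> \<open>\<open>tri_isomorphic\<close> needs the zero object in third position. Rotation
    puts the translate of the vanishing first vertex there.\<close>
  then have "idt D (sh D 1 ?A) = zero_ar D (sh D 1 ?A) (sh D 1 ?A)"
    using sh_idt[OF td(5)] sh_ar_zero[OF td(5) td(5)] by metis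
  then have "isomorphic D Y B"
    using tri_isomorphic[OF tri_rotate[OF t]] by blast
  then show "Y \<in> Dge"
    using isomorphic_sym Dge_strictly_full AB Y unfolding strictly_full_def by blast
qed

lemma ex_reflection:
  assumes "X \<in> Ob D"
  shows "\<exists>A e. is_reflection D Dge X A e"
proof -
  obtain A B f g h where AB: "A \<in> Dle" "B \<in> Dge" and t: "tri (sh D 1 A) X B f g h"
    using ex_tri_lt_0_ge_0[OF assms] .
  note td = triD[OF t]
  have "\<exists>!v. v \<in> Hom D B Y \<and> v \<cdot> g = x" if Y: "Y \<in> Dge" and x: "x \<in> Hom D X Y" for Y x
  proof -
    \<comment> \<open>The first vanishing gives existence of the factorisation through
      \<open>g\<close>, the second its uniqueness.\<close>
    have o: "orth (sh D 1 A) Y" "orth (sh D 1 (sh D 1 A)) Y"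
      using orth_sh_Dle_Dge AB Dle_sh Y by blast+
    obtain v where v: "v \<in> Hom D B Y" "v \<cdot> g = x"
      using tri_weak_cokernel[OF t x] orthD[OF o(1) comp_Hom[OF td(1) x]] by blast
    have "w = v" if "w \<in> Hom D B Y" "w \<cdot> g = x" for w
      using cancel_right[OF that(1) v(1) td(2)] tri_cancel_right[OF t o(2)] that v by simp
    then show ?thesis
      using v by blast
  qed
  then show ?thesis
    using AB td unfolding is_reflection_def by blast
qed

lemma ex_coreflection:
  assumes "X \<in> Ob D"
  shows "\<exists>A e. is_coreflection D Dle X A e"
proof -
  obtain A B f g h where AB: "A \<in> Dle" "B \<in> Dge" and t: "tri A X (sh D (- 1) B) f g h"
    using ex_tri_le_0_ge_1[OF assms] .
  note td = triD[OF t]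
  have "\<exists>!v. v \<in> Hom D Y A \<and> f \<cdot> v = x" if Y: "Y \<in> Dle" and x: "x \<in> Hom D Y X" for Y x
  proof -
    have o: "orth Y (sh D (- 1) B)" "orth Y (sh D (- 1) (sh D (- 1) B))"
      using orth_Dle_Dge AB Dge_sh_back Y by blast+
    obtain v where v: "v \<in> Hom D Y A" "f \<cdot> v = x"
      using tri_weak_kernel[OF t x] orthD[OF o(1) comp_Hom[OF x td(2)]] by blast
    have "w = v" if "w \<in> Hom D Y A" "f \<cdot> w = x" for w
      using cancel_left[OF that(1) v(1) td(1)] tri_cancel_left[OF t o(2)] that v by simp
    then show ?thesis
      using v by blast
  qed
  then show ?thesis
    using AB td unfolding is_coreflection_def by blast
qed

section \<open>Orthogonality to truncations and cohomology objects\<close>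

lemma trunc_ge_reflection:
  assumes "X \<in> Ob D"
  obtains e where "is_reflection D Dge X (trunc_ge D Dge 0 X) e"
proof -
  have "shifted D Dge 0 = Dge"
    using shifted_Dge_iff[of _ 0] sh_0 Dge_Ob by fastforce
  then show thesis
    using that someI_ex[OF ex_reflection[OF assms]] unfolding trunc_ge_def by auto
qed

lemma trunc_le_coreflection:
  assumes "X \<in> Ob D"
  obtains e where "is_coreflection D Dle X (trunc_le D Dle 0 X) e"
proof -
  have "shifted D Dle 0 = Dle"
    using shifted_Dle_iff[of _ 0] sh_0 Dle_Ob by fastforce
  then show thesis
    using that someI_ex[OF ex_coreflection[OF assms]] unfolding trunc_le_def by auto
qed

text \<open>Composition with the unit \<open>e\<close> is a bijection from Hom(H, Y) to Hom(X, Y)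
  that preserves zero.\<close>

lemma orth_reflection_iff:
  assumes e: "is_reflection D Dge X H e" and Y: "Y \<in> Dge"
  shows "orth H Y \<longleftrightarrow> orth X Y"
proof -
  have H: "e \<in> Hom D X H" "\<And>f. f \<in> Hom D X Y \<Longrightarrow> \<exists>!g. g \<in> Hom D H Y \<and> g \<cdot> e = f"
    using e Y unfolding is_reflection_def by auto
  have z: "zero_ar D H Y \<in> Hom D H Y" "zero_ar D H Y \<cdot> e = zero_ar D X Y"
    using zero_Hom comp_zero_left[OF H(1)] Hom_Ob[OF H(1)] Dge_Ob[OF Y] by auto
  show ?thesis
  proof
    assume "orth H Y"
    then show "orth X Y"
      unfolding orth_def using H(2) z(2) by metis
  next
    assume o: "orth X Y"
    show "orth H Y"
      unfolding orth_def
    proof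
      fix w assume w: "w \<in> Hom D H Y"
      then have "w \<cdot> e = zero_ar D X Y"
        using orthD[OF o comp_Hom[OF H(1)]] by blast
      then show "w = zero_ar D H Y"
        using H(2)[OF comp_Hom[OF H(1) w]] z w by auto
    qed
  qed
qed

lemma orth_coreflection_iff:
  assumes e: "is_coreflection D Dle Y K e" and X: "X \<in> Dle"
  shows "orth X K \<longleftrightarrow> orth X Y"
proof -
  have K: "e \<in> Hom D K Y" "\<And>f. f \<in> Hom D X Y \<Longrightarrow> \<exists>!g. g \<in> Hom D X K \<and> e \<cdot> g = f"
    using e X unfolding is_coreflection_def by auto
  have z: "zero_ar D X K \<in> Hom D X K" "e \<cdot> zero_ar D X K = zero_ar D X Y"
    using zero_Hom comp_zero_right[OF K(1)] Hom_Ob[OF K(1)] Dle_Ob[OF X] by auto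
  show ?thesis
  proof
    assume "orth X K"
    then show "orth X Y"
      unfolding orth_def using K(2) z(2) by metis
  next
    assume o: "orth X Y"
    show "orth X K"
      unfolding orth_def
    proof
      fix w assume w: "w \<in> Hom D X K"
      then have "e \<cdot> w = zero_ar D X Y"
        using orthD[OF o comp_Hom[OF _ K(1)]] by blast
      then show "w = zero_ar D X K"
        using K(2)[OF comp_Hom[OF w K(1)]] z w by auto
    qed
  qed
qed

text \<open>By the orthogonality criterion it suffices to test \<open>H\<close> against
  \<open>Y[-1]\<close>. This lies in \<open>Dge\<close>, so \<open>H\<close> may be replaced by
  \<open>X\<close>.\<close>

lemma reflection_Dle:
  assumes e: "is_reflection D Dge X H e" and X: "X \<in> Dle"
  shows "H \<in> Dle"
proof -
  have H: "H \<in> Ob D"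
    using e Dge_Ob unfolding is_reflection_def by blast
  have "orth (sh D 1 H) Y" if Y: "Y \<in> Dge" for Y
    using orth_reflection_iff[OF e Dge_sh_back[OF Y]] orth_Dle_Dge[OF X Y]
      orth_sh_left[OF H Dge_Ob[OF Y]] by simp
  then show ?thesis
    using Dle_iff_orth H by blast
qed

lemma coreflection_Dge:
  assumes e: "is_coreflection D Dle Y K e" and Y: "Y \<in> Dge"
  shows "K \<in> Dge"
proof -
  have K: "K \<in> Ob D"
    using e Dle_Ob unfolding is_coreflection_def by blast
  have "orth (sh D 1 X) K" if X: "X \<in> Dle" for X
    using orth_coreflection_iff[OF e Dle_sh[OF X]] orth_sh_Dle_Dge[OF X Y] by simp
  then show ?thesis
    using Dge_iff_orth K by blast
qed

lemma cohom_0_heart: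
  assumes "X \<in> Ob D"
  shows "cohom D Dle Dge 0 X \<in> Dle \<inter> Dge"
proof -
  obtain e where e: "is_coreflection D Dle X (trunc_le D Dle 0 X) e"
    using trunc_le_coreflection[OF assms] .
  then have M: "trunc_le D Dle 0 X \<in> Dle"
    by (simp add: is_coreflection_def)
  obtain r where r: "is_reflection D Dge (trunc_le D Dle 0 X) (cohom D Dle Dge 0 X) r"
    using trunc_ge_reflection[OF Dle_Ob[OF M]] sh_0[OF assms] by (auto simp: cohom_def)
  show ?thesis
    using reflection_Dle[OF r M] r by (simp add: is_reflection_def)
qed

text \<open>On \<open>Dle\<close> the inner truncation is an isomorphism, so \<open>cohom\<close> in
  degree 0 acts as the reflection into \<open>Dge\<close>.\<close>

lemma orth_cohom_0_left:
  assumes X: "X \<in> Dle" and Y: "Y \<in> Dge"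
  shows "orth (cohom D Dle Dge 0 X) Y \<longleftrightarrow> orth X Y"
proof -
  obtain e where e: "is_coreflection D Dle X (trunc_le D Dle 0 X) e"
    using trunc_le_coreflection[OF Dle_Ob[OF X]] .
  then have M: "trunc_le D Dle 0 X \<in> Dle"
    by (simp add: is_coreflection_def)
  obtain r where "is_reflection D Dge (trunc_le D Dle 0 X) (cohom D Dle Dge 0 X) r"
    using trunc_ge_reflection[OF Dle_Ob[OF M]] sh_0[OF Dle_Ob[OF X]] by (auto simp: cohom_def)
  then show ?thesis
    using orth_reflection_iff[OF _ Y] orth_isomorphic_left[OF coreflection_isomorphic[OF e X Dle_Ob[OF X]]]
    by blast
qed

text \<open>The inner truncation stays in \<open>Dge\<close>, where the outer one is an isomorphism,
  so only the coreflection remains.\<close>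

lemma orth_cohom_0_right:
  assumes Y: "Y \<in> Dge" and X: "X \<in> Dle"
  shows "orth X (cohom D Dle Dge 0 Y) \<longleftrightarrow> orth X Y"
proof -
  obtain e where e: "is_coreflection D Dle Y (trunc_le D Dle 0 Y) e"
    using trunc_le_coreflection[OF Dge_Ob[OF Y]] .
  have M: "trunc_le D Dle 0 Y \<in> Dge"
    using coreflection_Dge[OF e Y] .
  obtain r where "is_reflection D Dge (trunc_le D Dle 0 Y) (cohom D Dle Dge 0 Y) r"
    using trunc_ge_reflection[OF Dge_Ob[OF M]] sh_0[OF Dge_Ob[OF Y]] by (auto simp: cohom_def)
  from reflection_isomorphic[OF this M Dge_Ob[OF M]] show ?thesis
    using orth_isomorphic_right orth_coreflection_iff[OF e X] by blast
qed

end

section \<open>Tilting at a torsion theory\<close>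

locale t_structure_torsion = t_structure D Dle Dge
  for D :: "('o, 'a, 'm) triangulated_cat_scheme" (structure) and Dle Dge :: "'o set" +
  fixes T F :: "'o set"
  assumes torsion: "torsion_theory (heart D Dle Dge) T F"
begin

section \<open>The torsion theory expressed with arrows of the ambient category\<close>

lemma Hom_heart:
  assumes "X \<in> Dle \<inter> Dge" "Y \<in> Dle \<inter> Dge"
  shows "Hom (heart D Dle Dge) X Y = Hom D X Y"
  using assms by (auto simp: Hom_def heart_def full_subcat_def)

lemma heart_simps:
  "Ob (heart D Dle Dge) = Dle \<inter> Dge"
  "Ar (heart D Dle Dge) = {f \<in> Ar D. src D f \<in> Dle \<inter> Dge \<and> tgt D f \<in> Dle \<inter> Dge}"
  "src (heart D Dle Dge) = src D" "tgt (heart D Dle Dge) = tgt D"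
  "idt (heart D Dle Dge) = idt D" "comp (heart D Dle Dge) = comp D"
  "zero_ar (heart D Dle Dge) = zero_ar D"
  by (simp_all add: heart_def full_subcat_def)

lemma isomorphic_heart:
  assumes "X \<in> Dle \<inter> Dge" "Y \<in> Dle \<inter> Dge" "isomorphic D X Y"
  shows "isomorphic (heart D Dle Dge) X Y"
proof -
  obtain f g where f: "f \<in> Hom D X Y" and g: "g \<in> Hom D Y X"
    and inv: "g \<cdot> f = idt D X" "f \<cdot> g = idt D Y"
    using isomorphicE[OF assms(3)] .
  let ?H = "heart D Dle Dge"
  have fg: "f \<in> Hom ?H X Y" "g \<in> Hom ?H Y X"
    using f g Hom_heart assms(1,2) by auto
  have "is_iso ?H f"
    unfolding is_iso_def HomD(2,3)[OF fg(1)]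
    using HomD(1)[OF fg(1)] fg(2) inv unfolding heart_simps by blast
  then show ?thesis
    unfolding isomorphic_def using fg(1) by blast
qed

lemma torsion_heart: "X \<in> T \<Longrightarrow> X \<in> Dle \<inter> Dge" "Y \<in> F \<Longrightarrow> Y \<in> Dle \<inter> Dge"
  using torsion by (auto simp: torsion_theory_def strictly_full_def heart_simps)

lemma torsion_isomorphic:
  assumes "isomorphic D X Y" "Y \<in> Dle \<inter> Dge"
  shows "X \<in> T \<Longrightarrow> Y \<in> T" "X \<in> F \<Longrightarrow> Y \<in> F"
proof -
  have "strictly_full (heart D Dle Dge) T" "strictly_full (heart D Dle Dge) F"
    using torsion by (simp_all add: torsion_theory_def)
  then show "X \<in> T \<Longrightarrow> Y \<in> T" "X \<in> F \<Longrightarrow> Y \<in> F"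
    using isomorphic_heart[OF torsion_heart(1) assms(2,1)]
      isomorphic_heart[OF torsion_heart(2) assms(2,1)] assms(2)
    by (simp_all add: strictly_full_def heart_simps)
qed

lemma orth_torsion:
  assumes "X \<in> T" "Y \<in> F"
  shows "orth X Y"
proof -
  have "Hom (heart D Dle Dge) X Y = {zero_ar D X Y}"
    using torsion assms by (simp add: torsion_theory_def heart_simps)
  then show ?thesis
    using Hom_heart[OF torsion_heart(1)[OF assms(1)] torsion_heart(2)[OF assms(2)]]
    by (simp add: orth_def)
qed

lemma ex_torsion_sequence:
  assumes A: "A \<in> Dle \<inter> Dge"
  obtains X Y f g where "X \<in> T" "Y \<in> F" "f \<in> Hom D X A" "g \<in> Hom D A Y"
    "g \<cdot> f = zero_ar D X Y"
    "\<forall>W \<in> Dle \<inter> Dge. \<forall>x \<in> Hom D W A. g \<cdot> x = zero_ar D W Y \<longrightarrow>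
      (\<exists>!u. u \<in> Hom D W X \<and> f \<cdot> u = x)"
    "\<forall>W \<in> Dle \<inter> Dge. \<forall>x \<in> Hom D A W. x \<cdot> f = zero_ar D X W \<longrightarrow>
      (\<exists>!u. u \<in> Hom D Y W \<and> u \<cdot> g = x)"
proof -
  let ?H = "heart D Dle Dge"
  obtain X Y f g where XY: "X \<in> T" "Y \<in> F" "f \<in> Hom ?H X A" "g \<in> Hom ?H A Y" "short_exact ?H f g"
    using torsion A unfolding torsion_theory_def heart_simps by blast
  have fg: "f \<in> Hom D X A" "g \<in> Hom D A Y"
    using XY Hom_heart A torsion_heart by blast+
  note st = HomD(2,3)[OF fg(1)] HomD(2,3)[OF fg(2)]
  have gf: "g \<cdot> f = zero_ar D X Y"
    using XY(5) unfolding short_exact_def is_kernel_def heart_simps st by blast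
  have ker: "\<exists>!u. u \<in> Hom D W X \<and> f \<cdot> u = x"
    if "W \<in> Dle \<inter> Dge" "x \<in> Hom D W A" "g \<cdot> x = zero_ar D W Y" for W x
  proof -
    have "x \<in> Hom ?H W A"
      using that A Hom_heart by blast
    then have "\<exists>!u. u \<in> Hom ?H W X \<and> f \<cdot> u = x"
      using XY(5) that(1,3) unfolding short_exact_def is_kernel_def heart_simps st by blast
    then show ?thesis
      using Hom_heart[OF that(1) torsion_heart(1)[OF XY(1)]] by simp
  qed
  have coker: "\<exists>!u. u \<in> Hom D Y W \<and> u \<cdot> g = x"
    if "W \<in> Dle \<inter> Dge" "x \<in> Hom D A W" "x \<cdot> f = zero_ar D X W" for W x
  proof -
    have "x \<in> Hom ?H A W"
      using that A Hom_heart by blast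
    then have "\<exists>!u. u \<in> Hom ?H Y W \<and> u \<cdot> g = x"
      using XY(5) that(1,3) unfolding short_exact_def is_cokernel_def heart_simps st by blast
    then show ?thesis
      using Hom_heart[OF torsion_heart(2)[OF XY(2)] that(1)] by simp
  qed
  show thesis
    using that[OF XY(1,2) fg gf] ker coker by blast
qed

text \<open>
  The fibre \<open>K\<close> of the quotient map \<open>A \<rightarrow> Y\<close> lies in \<open>D\<^sup>\<le>\<^sup>0\<close> because the quotient map is epi in the heart;
  then \<open>K\<close> and the torsion part \<open>X\<close> are both kernels of it, so that they are isomorphic.
\<close>

lemma ex_torsion_tri:
  assumes A: "A \<in> Dle \<inter> Dge"
  obtains X Y f g h where "X \<in> T" "Y \<in> F" "tri X A Y f g h"
proof -
  obtain X Y f g where XY: "X \<in> T" "Y \<in> F" and f: "f \<in> Hom D X A" and g: "g \<in> Hom D A Y"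
    and gf: "g \<cdot> f = zero_ar D X Y"
    and ker': "\<forall>W \<in> Dle \<inter> Dge. \<forall>x \<in> Hom D W A. g \<cdot> x = zero_ar D W Y \<longrightarrow>
      (\<exists>!u. u \<in> Hom D W X \<and> f \<cdot> u = x)"
    and coker': "\<forall>W \<in> Dle \<inter> Dge. \<forall>x \<in> Hom D A W. x \<cdot> f = zero_ar D X W \<longrightarrow>
      (\<exists>!u. u \<in> Hom D Y W \<and> u \<cdot> g = x)"
    using ex_torsion_sequence[OF A] .
  note ker = ker'[rule_format] and coker = coker'[rule_format]
  have X: "X \<in> Dle" "X \<in> Dge" "X \<in> Ob D" and Y: "Y \<in> Dle" "Y \<in> Dge" "Y \<in> Ob D"
    and AO: "A \<in> Ob D"
    using torsion_heart XY A Dle_Ob by auto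
  \<comment> \<open>The cokernel property tests only objects of the heart. For \<open>W\<close> in
    \<open>Dge\<close>, its coreflection \<open>K\<close> into \<open>Dle\<close> lies in the heart,
    and \<open>m\<close> factors through \<open>K\<close> because \<open>Y\<close> is in
    \<open>Dle\<close>.\<close>
  have epi: "m = zero_ar D Y W"
    if W: "W \<in> Dge" and m: "m \<in> Hom D Y W" "m \<cdot> g = zero_ar D A W" for W m
  proof -
    obtain K e where e: "is_coreflection D Dle W K e"
      using ex_coreflection Dge_Ob W by blast
    then have K: "K \<in> Dle \<inter> Dge" "K \<in> Ob D"
      using coreflection_Dge W Dle_Ob unfolding is_coreflection_def by auto
    have eK: "e \<in> Hom D K W"
      and u: "\<And>B x. \<lbrakk>B \<in> Dle; x \<in> Hom D B W\<rbrakk> \<Longrightarrow> \<exists>!v. v \<in> Hom D B K \<and> e \<cdot> v = x"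
      using e unfolding is_coreflection_def by auto
    obtain n where n: "n \<in> Hom D Y K" "e \<cdot> n = m"
      using u[OF Y(1) m(1)] by blast
    have zA: "zero_ar D A K \<in> Hom D A K" and zY: "zero_ar D Y K \<in> Hom D Y K"
      using zero_Hom AO Y K by auto
    have "e \<cdot> (n \<cdot> g) = zero_ar D A W"
      using comp_assoc[OF g n(1) eK] n(2) m(2) by simp
    moreover have "e \<cdot> zero_ar D A K = zero_ar D A W"
      using comp_zero_right[OF eK AO] .
    ultimately have ng: "n \<cdot> g = zero_ar D A K"
      using u[OF _ zero_Hom[OF AO Dge_Ob[OF W]]] A comp_Hom[OF g n(1)] zA by blast
    have "zero_ar D A K \<cdot> f = zero_ar D X K" "zero_ar D Y K \<cdot> g = zero_ar D A K"
      using comp_zero_left f g K by auto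
    then have "n = zero_ar D Y K"
      using coker[OF K(1) zA] ng n(1) zY by blast
    then show ?thesis
      using n(2) comp_zero_right[OF eK Y(3)] by simp
  qed
  obtain C g' h' where t: "tri A Y C g g' h'"
    using ex_cone[OF g] .
  let ?K = "sh D (- 1) C"
  obtain k where k: "tri ?K A Y k g g'"
    using tri_rotate_back[OF t] by blast
  note kd = triD[OF k] and td = triD[OF t]
  have "orth C W" if W: "W \<in> Dge" for W
    unfolding orth_def
  proof
    fix w assume w: "w \<in> Hom D C W"
    have "(w \<cdot> g') \<cdot> g = zero_ar D A W"
      using comp_assoc[OF g td(2) w] tri_comp_zero[OF t] comp_zero_right[OF w AO] by simp
    then have "w \<cdot> g' = zero_ar D Y W"
      using epi[OF W comp_Hom[OF td(2) w]] by blast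
    then show "w = zero_ar D C W"
      using tri_cancel_right[OF t orth_sh_Dle_Dge[of A W] w] A W by blast
  qed
  then have K_le: "?K \<in> Dle"
    using Dle_iff_orth kd(5) td(7) by (simp add: sh_sh sh_0)
  \<comment> \<open>The fibre is an extension of \<open>A\<close> by \<open>Y[-1]\<close>, both in
    \<open>Dge\<close>.\<close>
  have "orth (sh D 1 W) ?K" if W: "W \<in> Dle" for W
    using tri_orth_right[OF tri_rotate_back[OF k]] orth_sh_Dle_Dge[OF W] Dge_sh_back[OF Y(2)] A
      sh_Ob[OF Dle_Ob[OF W]] by blast
  then have K_ge: "?K \<in> Dge"
    using Dge_iff_orth kd(5) by blast
  obtain u where u: "u \<in> Hom D ?K X" "f \<cdot> u = k"
    using ker[OF _ kd(1) tri_comp_zero[OF k]] K_le K_ge by blast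
  obtain v where v: "v \<in> Hom D X ?K" "k \<cdot> v = f"
    using tri_weak_kernel[OF k f gf] .
  have "f \<cdot> (u \<cdot> v) = f" "f \<cdot> idt D X = f"
    using comp_assoc[OF v(1) u(1) f] u v comp_idt_right[OF f] by auto
  then have uv: "u \<cdot> v = idt D X"
    using ker[OF _ f gf] X comp_Hom[OF v(1) u(1)] idt_Hom[OF X(3)] by blast
  have "k \<cdot> (v \<cdot> u) = k \<cdot> idt D ?K"
    using comp_assoc[OF u(1) v(1) kd(1)] u v comp_idt_right[OF kd(1)] by simp
  \<comment> \<open>Here \<open>k\<close> can be cancelled because the fibre lies in
    \<open>Dle\<close> and so has no nonzero arrow to \<open>Y[-1]\<close>.\<close>
  then have vu: "v \<cdot> u = idt D ?K"
    using cancel_left[OF comp_Hom[OF u(1) v(1)] idt_Hom[OF kd(5)] kd(1)]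
      tri_cancel_left[OF k orth_Dle_Dge[OF K_le Y(2)]] by blast
  have "isomorphic D X ?K"
    using isomorphicI[OF v(1) u(1) uv vu] .
  then have "?K \<in> T"
    using torsion_isomorphic(1) K_le K_ge XY by blast
  then show thesis
    using that XY k by blast
qed

text \<open>If \<open>A\<close> is orthogonal to \<open>F\<close>, its map to the torsion-free
  quotient \<open>Y\<close> is zero. The identity of \<open>Y\<close> then factors through
  \<open>X[1]\<close>, which is orthogonal to \<open>Y\<close>, so \<open>Y\<close> vanishes and
  \<open>A\<close> is isomorphic to its torsion part.\<close>

lemma torsion_iff_orth: "A \<in> T \<longleftrightarrow> A \<in> Dle \<inter> Dge \<and> (\<forall>Y \<in> F. orth A Y)"
proof
  assume "A \<in> T"
  then show "A \<in> Dle \<inter> Dge \<and> (\<forall>Y \<in> F. orth A Y)"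
    using torsion_heart orth_torsion by blast
next
  assume A: "A \<in> Dle \<inter> Dge \<and> (\<forall>Y \<in> F. orth A Y)"
  then obtain X Y f g h where XY: "X \<in> T" "Y \<in> F" and t: "tri X A Y f g h"
    using ex_torsion_tri by blast
  note td = triD[OF t]
  have "idt D Y \<cdot> g = zero_ar D A Y"
    using A XY(2) orthD td(2) comp_idt_left by metis
  then have "idt D Y = zero_ar D Y Y"
    using tri_cancel_right[OF t _ idt_Hom[OF td(7)]] orth_sh_Dle_Dge torsion_heart XY by blast
  then show "A \<in> T"
    using tri_isomorphic[OF t] torsion_isomorphic(1) A XY by blast
qed

lemma torsion_free_iff_orth: "A \<in> F \<longleftrightarrow> A \<in> Dle \<inter> Dge \<and> (\<forall>X \<in> T. orth X A)"
proof
  assume "A \<in> F"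
  then show "A \<in> Dle \<inter> Dge \<and> (\<forall>X \<in> T. orth X A)"
    using torsion_heart orth_torsion by blast
next
  assume A: "A \<in> Dle \<inter> Dge \<and> (\<forall>X \<in> T. orth X A)"
  then obtain X Y f g h where XY: "X \<in> T" "Y \<in> F" and t: "tri X A Y f g h"
    using ex_torsion_tri by blast
  note td = triD[OF t]
  have "f \<cdot> idt D X = zero_ar D X A"
    using A XY(1) orthD td(1) comp_idt_right by metis
  then have "idt D X = zero_ar D X X"
    using tri_cancel_left[OF t _ idt_Hom[OF td(5)]] orth_Dle_Dge torsion_heart XY by blast
  then have "idt D (sh D 1 X) = zero_ar D (sh D 1 X) (sh D 1 X)"
    using sh_idt[OF td(5)] sh_ar_zero[OF td(5) td(5)] by metis
  then have "isomorphic D A Y"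
    using tri_isomorphic[OF tri_rotate[OF t]] by blast
  then show "A \<in> F"
    using isomorphic_sym torsion_isomorphic(2) A XY by blast
qed

lemma cohom_0_torsion_iff:
  assumes "X \<in> Dle"
  shows "cohom D Dle Dge 0 X \<in> T \<longleftrightarrow> (\<forall>Y \<in> F. orth X Y)"
  using torsion_iff_orth[of "cohom D Dle Dge 0 X"] cohom_0_heart[OF Dle_Ob[OF assms]] orth_cohom_0_left[OF assms]
    torsion_heart(2) by blast

lemma cohom_0_torsion_free_iff:
  assumes "Y \<in> Dge"
  shows "cohom D Dle Dge 0 Y \<in> F \<longleftrightarrow> (\<forall>X \<in> T. orth X Y)"
  using torsion_free_iff_orth[of "cohom D Dle Dge 0 Y"] cohom_0_heart[OF Dge_Ob[OF assms]] orth_cohom_0_right[OF assms]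
    torsion_heart(1) by blast

text \<open>The degree 0 cohomology of \<open>X\<close> is a torsion object, hence orthogonal to
  \<open>Y\<close>; for targets in \<open>Dge\<close> this is the same as orthogonality of
  \<open>X\<close> itself.\<close>

lemma orth_tilt:
  assumes X: "X \<in> Dle" "\<forall>Y \<in> F. orth X Y" and Y: "Y \<in> Dge" "\<forall>X \<in> T. orth X Y"
  shows "orth X Y"
proof -
  have "cohom D Dle Dge 0 X \<in> T"
    using cohom_0_torsion_iff X by blast
  then show ?thesis
    using orth_cohom_0_left X Y by blast
qed

text \<open>
  This triangle is the tilted truncation up to a shift by one, which is why \<open>A\<close> is taken in \<open>D\<^sup>\<le>\<^sup>0\<close>
  and not in \<open>D\<^sup>\<le>\<^sup>1\<close>.
\<close>

lemma ex_tilt_tri: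
  assumes X: "X \<in> Ob D"
  obtains A B f g h where "A \<in> Dle" "\<forall>Y \<in> F. orth A Y" "B \<in> Dge" "\<forall>W \<in> T. orth W B"
    "tri A X B f g h"
proof -
  obtain P B0 a b c where P: "P \<in> Dle" "B0 \<in> Dge" and t0: "tri P X (sh D (- 1) B0) a b c"
    using ex_tri_le_0_ge_1[OF X] .
  obtain N H n r s where N: "N \<in> Dle" "H \<in> Dge" and t1: "tri (sh D 1 N) P H n r s"
    using ex_tri_lt_0_ge_0 Dle_Ob P by blast
  \<comment> \<open>The rotated triangle \<open>P -> H -> N[2]\<close> exhibits \<open>H\<close> as
    an extension of objects of \<open>Dle\<close>.\<close>
  have "orth (sh D 1 H) W" if W: "W \<in> Dge" for W
    using tri_orth_left[OF tri_rotate[OF t1] orth_Dle_Dge[OF P(1) W]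
        orth_Dle_Dge[OF Dle_sh[OF Dle_sh[OF N(1)]] W]] orth_sh_left Dge_Ob W N sh_Ob by simp
  then have "H \<in> Dle \<inter> Dge"
    using Dle_iff_orth Dge_Ob N by blast
  then obtain K Y k q l where KY: "K \<in> T" "Y \<in> F" and t2: "tri K H Y k q l"
    using ex_torsion_tri by blast
  have KH: "K \<in> Dle" "K \<in> Ob D" and YH: "Y \<in> Dge"
    using torsion_heart KY Dle_Ob by auto
  obtain C k' k'' where t3: "tri P Y C (q \<cdot> r) k' k''"
    using ex_cone[OF comp_Hom[OF triD(2)[OF t1] triD(2)[OF t2]]] .
  let ?A = "sh D (- 1) C"
  note C = triD(7)[OF t3]
  obtain m where t4: "tri ?A P Y m (q \<cdot> r) k'"
    using tri_rotate_back[OF t3] by blast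
  \<comment> \<open>The octahedron on \<open>P -> H -> Y\<close>, whose cones are
    \<open>N[2]\<close>, \<open>K[1]\<close> and \<open>C\<close> for the composite. Translated
    back, it makes the fibre \<open>?A\<close> an extension of \<open>K\<close> by
    \<open>N[1]\<close>.\<close>
  obtain u v w where "tri (sh D 1 (sh D 1 N)) C (sh D 1 K) u v w"
    using octahedral[OF tri_rotate[OF t1] tri_rotate[OF t2] t3] .
  from tri_sh_back[OF this] obtain u v w where t5: "tri (sh D 1 N) ?A K u v w"
    using sh_sh sh_0 KH sh_Ob[OF Dle_Ob[OF N(1)], of 1] by auto
  have "orth (sh D 1 ?A) W" if W: "W \<in> Dge" for W
    using tri_orth_left[OF t5 orth_Dle_Dge[OF Dle_sh[OF N(1)] W] orth_Dle_Dge[OF KH(1) W]]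
      orth_sh_left[OF sh_Ob[OF C] Dge_Ob[OF W]] sh_Ob[OF Dge_Ob[OF W]] by simp
  then have A_le: "?A \<in> Dle"
    using Dle_iff_orth C sh_Ob by blast
  have A_F: "\<forall>Z \<in> F. orth ?A Z"
    using tri_orth_left[OF t5] orth_sh_Dle_Dge[OF N(1)] orth_torsion[OF KY(1)] torsion_heart Dge_Ob
    by blast
  obtain B i j where t6: "tri ?A X B (a \<cdot> m) i j"
    using ex_cone[OF comp_Hom[OF triD(1)[OF t4] triD(1)[OF t0]]] .
  \<comment> \<open>The second octahedron, on \<open>?A -> P -> X\<close>: \<open>B\<close> is an
    extension of \<open>B0[-1]\<close> by \<open>Y\<close>. Objects of \<open>T\<close> are
    orthogonal to \<open>Y\<close> by torsion and to \<open>B0[-1]\<close> by degree.\<close>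
  obtain u v w where t7: "tri Y B (sh D (- 1) B0) u v w"
    using octahedral[OF t4 t0 t6] .
  have "orth (sh D 1 W) B" if W: "W \<in> Dle" for W
    using tri_orth_right[OF t7 orth_sh_Dle_Dge[OF W YH] orth_sh_Dle_Dge[OF W Dge_sh_back[OF P(2)]]]
      sh_Ob Dle_Ob W by blast
  then have B_ge: "B \<in> Dge"
    using Dge_iff_orth triD(7)[OF t6] by blast
  have B_T: "\<forall>W \<in> T. orth W B"
    using tri_orth_right[OF t7 orth_torsion[OF _ KY(2)]] orth_Dle_Dge[OF _ P(2)] torsion_heart Dle_Ob
    by blast
  show thesis
    using that[OF A_le A_F B_ge B_T t6] .
qed

section \<open>The axioms for the tilted pair\<close>

lemma tilt_le_eq:
  "{A \<in> shifted D Dle 1. cohom D Dle Dge 1 A \<in> T}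
    = {A \<in> Ob D. sh D 1 A \<in> Dle \<and> (\<forall>Y \<in> F. orth (sh D 1 A) Y)}"
proof -
  have "cohom D Dle Dge 1 A = cohom D Dle Dge 0 (sh D 1 A)" if "A \<in> Ob D" for A
    using sh_0 sh_Ob that by (simp add: cohom_def)
  then show ?thesis
    using shifted_Dle_iff cohom_0_torsion_iff by auto
qed

lemma tilt_ge_eq:
  "{A \<in> Dge. cohom D Dle Dge 0 A \<in> F} = {A \<in> Dge. \<forall>X \<in> T. orth X A}"
  using cohom_0_torsion_free_iff by blast

lemma t_structure_tilt:
  "t_structure D {A \<in> shifted D Dle 1. cohom D Dle Dge 1 A \<in> T} {A \<in> Dge. cohom D Dle Dge 0 A \<in> F}"
  unfolding tilt_le_eq tilt_ge_eq
proof (unfold_locales)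
  let ?L = "{A \<in> Ob D. sh D 1 A \<in> Dle \<and> (\<forall>Y \<in> F. orth (sh D 1 A) Y)}"
  let ?G = "{A \<in> Dge. \<forall>X \<in> T. orth X A}"
  have LO: "?L \<subseteq> Ob D" and GO: "?G \<subseteq> Ob D"
    using Dge_Ob by auto
  show "strictly_full D ?L"
    unfolding strictly_full_def
  proof (intro conjI ballI impI LO)
    fix X Y assume X: "X \<in> ?L" and Y: "Y \<in> Ob D" and i: "isomorphic D X Y"
    note i' = isomorphic_sh[OF i, of 1]
    have "sh D 1 Y \<in> Dle"
      using Dle_strictly_full i' X sh_Ob[OF Y] unfolding strictly_full_def by blast
    then show "Y \<in> ?L"
      using X Y orth_isomorphic_left[OF i'] by blast
  qed
  show "strictly_full D ?G"
    unfolding strictly_full_def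
  proof (intro conjI ballI impI GO)
    fix X Y assume X: "X \<in> ?G" and Y: "Y \<in> Ob D" and i: "isomorphic D X Y"
    have "Y \<in> Dge"
      using Dge_strictly_full i X Y unfolding strictly_full_def by blast
    then show "Y \<in> ?G"
      using X orth_isomorphic_right[OF i] by blast
  qed
  show "Hom D X Y = {zero_ar D X Y}" if X: "X \<in> ?L" and Y: "Y \<in> shifted D ?G 1" for X Y
  proof -
    have YO: "Y \<in> Ob D" "sh D 1 Y \<in> ?G"
      using Y shifted_iff[OF GO] by auto
    \<comment> \<open>Both conditions concern the translates by one: \<open>?L\<close> constrains
      \<open>X[1]\<close>, and \<open>Y\<close> lies in the shifted \<open>?G\<close> exactly when
      \<open>Y[1]\<close> is in \<open>?G\<close>.\<close>
    have "orth (sh D 1 X) (sh D 1 Y)"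
      using orth_tilt X YO by blast
    then show ?thesis
      using orth_sh Hom_eq_zero_iff_orth X YO by blast
  qed
  \<comment> \<open>For \<open>A\<close> in \<open>?L\<close>, the object \<open>A[2]\<close> is
    orthogonal to \<open>F\<close> by degree alone, since \<open>A[1]\<close> is in
    \<open>Dle\<close> and \<open>F\<close> lies in \<open>Dge\<close>.\<close>
  show "?L \<subseteq> shifted D ?L 1"
    using shifted_iff[OF LO] Dle_sh orth_sh_Dle_Dge torsion_heart sh_Ob by auto
  show "shifted D ?G 1 \<subseteq> ?G"
  proof
    fix Y assume "Y \<in> shifted D ?G 1"
    then obtain Z where Z: "Z \<in> ?G" "Y = sh D (- 1) Z"
      by (auto simp: shifted_def)
    then show "Y \<in> ?G"
      using Dge_sh_back orth_Dle_Dge torsion_heart by blast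
  qed
  show "\<exists>A \<in> ?L. \<exists>B \<in> shifted D ?G 1. \<exists>f \<in> Hom D A X. \<exists>g \<in> Hom D X B. \<exists>h. (f, g, h) \<in> dist D"
    if X: "X \<in> Ob D" for X
  proof -
    \<comment> \<open>Decomposing \<open>X[1]\<close> and translating back by one puts
      \<open>A[-1]\<close> in \<open>?L\<close> and \<open>B[-1]\<close> in the shifted
      \<open>?G\<close>.\<close>
    obtain A B f g h where A: "A \<in> Dle" "\<forall>Y \<in> F. orth A Y" and B: "B \<in> Dge" "\<forall>W \<in> T. orth W B"
      and t: "tri A (sh D 1 X) B f g h"
      using ex_tilt_tri[OF sh_Ob[OF X]] .
    obtain f g h where t': "tri (sh D (- 1) A) X (sh D (- 1) B) f g h"
      using tri_sh_back[OF t] X by (auto simp: sh_sh sh_0)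
    have "sh D (- 1) A \<in> ?L"
      using A Dle_Ob sh_Ob by (simp add: sh_sh sh_0)
    moreover have "sh D (- 1) B \<in> shifted D ?G 1"
      using B by (auto simp: shifted_def)
    ultimately show ?thesis
      using triD[OF t'] by blast
  qed
qed

end

theorem proposition2p15:
  fixes D :: "('o, 'a, 'm) triangulated_cat_scheme"
    and Dle Dge T F :: "'o set"
  assumes "t_structure D Dle Dge"
    and "torsion_theory (heart D Dle Dge) T F"
  shows "t_structure D
    {A \<in> shifted D Dle 1. cohom D Dle Dge 1 A \<in> T}
    {A \<in> Dge. cohom D Dle Dge 0 A \<in> F}"
proof -
  interpret t_structure_torsion D Dle Dge T F
    using assms by (simp add: t_structure_torsion_def t_structure_torsion_axioms_def)
  show ?thesis
    by (rule t_structure_tilt)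
qed

end
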